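(* For every $\epsilon>0$ there is $C_\epsilon$ such that for all $N\ge1$ and all $\phi\in L^2(\mathcal{M})$, $$\|e^{it\Box}P_{\le N}\phi\|_{L^4_{t,\mathbf{x}}([0,1]\times\mathcal{M})}\le C_\epsilon N^{\epsilon}\|P_{\le N}\phi\|_{L^2(\mathcal{M})}.$$
   Context: $\mathcal{M}=\mathbb{R}\times\mathbb{T}$, $\mathbb{T}=\mathbb{R}/\mathbb{Z}$, $\mathbf{x}=(x,y)$. Fourier transform $\widehat f(\xi,k)=\int_{\mathcal{M}}e^{-2\pi i(\xi x+ky)}f\,dx\,dy$, $(\xi,k)\in\mathbb{R}\times\mathbb{Z}$. $\Box=\partial_x^2-\partial_y^2$ and $e^{it\Box}$ is the Fourier multiplier $e^{-4\pi^2it(\xi^2-k^2)}$. $\varphi$ is a fixed smooth radial function on $\mathbb{R}$ equal to $1$ on $|x|\le1$ and $0$ on $|x|\ge2$; $P_{\le N}$ is the Fourier multiplier $\varphi(\xi/N)\varphi(k/N)$. *)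

theory Defs
  imports "HOL-Analysis.Analysis"
begin

definition smooth_fun :: "(real \<Rightarrow> real) \<Rightarrow> bool" where
  "smooth_fun f \<longleftrightarrow> (\<forall>n. (deriv ^^ n) f differentiable_on UNIV)"

definition cutoff :: "(real \<Rightarrow> real) \<Rightarrow> bool" where
  "cutoff \<phi> \<longleftrightarrow> smooth_fun \<phi> \<and> (\<forall>x. \<phi> (-x) = \<phi> x)
     \<and> (\<forall>x. \<bar>x\<bar> \<le> 1 \<longrightarrow> \<phi> x = 1) \<and> (\<forall>x. \<bar>x\<bar> \<ge> 2 \<longrightarrow> \<phi> x = 0)"

definition freq_measure :: "(real \<times> int) measure" where
  "freq_measure = lborel \<Otimes>\<^sub>M count_space UNIV"

text \<open>An L^2(\<M>) function \<phi> is given through its Fourier transform g = \<phi>-hat \<in> L^2(\<real> \<times> \<int>).\<close>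
definition L2_freq :: "(real \<times> int \<Rightarrow> complex) \<Rightarrow> bool" where
  "L2_freq g \<longleftrightarrow> g \<in> borel_measurable freq_measure
     \<and> (\<integral>\<^sup>+ p. ennreal (norm (g p) ^ 2) \<partial>freq_measure) < \<infinity>"

definition PN_mult :: "(real \<Rightarrow> real) \<Rightarrow> real \<Rightarrow> real \<Rightarrow> int \<Rightarrow> real" where
  "PN_mult \<phi> N \<xi> k = \<phi> (\<xi> / N) * \<phi> (real_of_int k / N)"

text \<open>(e^{it\<box>} P_{\<le>N} \<phi>)(x,y), where \<phi> has Fourier transform g
  (inverse Fourier transform on \<real> \<times> \<bbbT>; y is the representative in \<real> of a point in \<bbbT>).\<close>
definition evolPN ::
  "(real \<Rightarrow> real) \<Rightarrow> real \<Rightarrow> (real \<times> int \<Rightarrow> complex) \<Rightarrow> real \<Rightarrow> real \<Rightarrow> real \<Rightarrow> complex" where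
  "evolPN \<phi> N g t x y =
     (\<Sum>\<^sub>\<infinity> k::int. \<integral> \<xi>. cis (2 * pi * (\<xi> * x + real_of_int k * y))
        * cis (- 4 * pi ^ 2 * t * (\<xi> ^ 2 - (real_of_int k) ^ 2))
        * complex_of_real (PN_mult \<phi> N \<xi> k) * g (\<xi>, k) \<partial>lborel)"

definition L4_pow4 :: "(real \<Rightarrow> real) \<Rightarrow> real \<Rightarrow> (real \<times> int \<Rightarrow> complex) \<Rightarrow> ennreal" where
  "L4_pow4 \<phi> N g =
     (\<integral>\<^sup>+ t. indicator {0..1} t * (\<integral>\<^sup>+ x. (\<integral>\<^sup>+ y. indicator {0..1} y *
        ennreal (norm (evolPN \<phi> N g t x y) ^ 4) \<partial>lborel) \<partial>lborel) \<partial>lborel)"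

definition L2_pow2 :: "(real \<Rightarrow> real) \<Rightarrow> real \<Rightarrow> (real \<times> int \<Rightarrow> complex) \<Rightarrow> ennreal" where
  "L2_pow2 \<phi> N g =
     (\<integral>\<^sup>+ x. (\<integral>\<^sup>+ y. indicator {0..1} y *
        ennreal (norm (evolPN \<phi> N g 0 x y) ^ 2) \<partial>lborel) \<partial>lborel)"

end

theory Submission
  imports Defs "HOL-Probability.Characteristic_Functions"
begin

text \<open>
  The square of the solution is an integral over pairs of frequencies of
  \<open>F(p\<^sub>1) F(p\<^sub>2)\<close> against a plane wave in \<open>(t, x, y)\<close>. Integrating its squared modulus against a
  Gaussian in \<open>t\<close>, a wide Gaussian in \<open>x\<close> and Lebesgue measure in \<open>y\<close> turns it into a quadratic
  form whose kernel is concentrated on pairs with equal total frequency and almost equal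
  resonance function \<open>\<xi>\<^sub>1\<^sup>2 - k\<^sub>1\<^sup>2 + \<xi>\<^sub>2\<^sup>2 - k\<^sub>2\<^sup>2\<close>. By Schur's test the norm of this form is at most
  the measure of a unit neighbourhood of a hyperbola \<open>a\<^sup>2 - b\<^sup>2 = \<tau>\<close>, with \<open>a\<close> real and \<open>b\<close> a half
  integer of size at most a multiple of \<open>N\<close>. A slice has length \<open>O((1 + |b\<^sup>2 + \<tau>|)\<^bsup>-1/2\<^esup>)\<close>, and the
  sum over \<open>b\<close> is \<open>O(N\<^sup>\<epsilon>)\<close> uniformly in \<open>\<tau>\<close>. Plancherel converts the frequency norm of \<open>F\<close> back
  to the norm of the data.
\<close>

subsection \<open>The TT* identity and Schur's test\<close>

text \<open>The weights are dictated by the tools. The TT* argument uses a probability measure in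
  space-time, whereas x ranges over the whole line with Lebesgue measure. So x gets a Gaussian of
  width \<open>\<sigma>\<close>: the row integrals of the kernel then carry the factor
  \<open>1 / (\<sigma> * sqrt (2 * pi))\<close>, the normalisation of the weight cancels it, and
  Fatou's lemma removes the weight. Since the characteristic function of a Gaussian is again a
  Gaussian, the kernel is explicit and nonnegative, and its row integrals can be estimated by hand.
  The loss in N has a geometric cause. For \<tau> = 0 the hyperbola degenerates to the lines a = b
  and a = -b, the slices have length about 1/(1 + |b|), and the sum over b is harmonic, of size log
  N. The second obstacle is that the right-hand side is a norm in physical space. It calls for the
  lower bound in Plancherel's theorem on the line, which is proved here for functions in both L1 and
  L2 by regularising with the same Gaussians.\<close>

lemma borel_measurable_cnj [measurable]: "cnj \<in> borel_measurable borel"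
  by (intro borel_measurable_continuous_onI continuous_intros)

text \<open>The absolute convergence behind every use of Fubini in \<open>TTstar_identity\<close>.
  The majorant \<open>norm (G p) * norm (G q)\<close> does not depend on s, so it suffices that
  \<nu> has mass 1.\<close>

lemma TTstar_integrable:
  fixes e :: "'s \<times> 'p \<Rightarrow> complex" and G :: "'p \<Rightarrow> complex"
  assumes \<mu>: "sigma_finite_measure \<mu>" and \<nu>: "prob_space \<nu>"
    and e[measurable]: "e \<in> borel_measurable (\<nu> \<Otimes>\<^sub>M \<mu>)" and e1: "\<And>z. norm (e z) \<le> 1"
    and G: "integrable \<mu> G"
  shows "integrable (\<nu> \<Otimes>\<^sub>M (\<mu> \<Otimes>\<^sub>M \<mu>))
           (\<lambda>(s, p, q). e (s, p) * G p * cnj (e (s, q) * G q))"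
proof -
  interpret \<mu>: sigma_finite_measure \<mu> by fact
  interpret \<nu>: prob_space \<nu> by fact
  interpret mm: pair_sigma_finite \<mu> \<mu> ..
  have [measurable]: "G \<in> borel_measurable \<mu>" using G by auto
  have fin: "(\<integral>\<^sup>+ p. norm (G p) \<partial>\<mu>) < \<infinity>"
    using G by (simp add: integrable_iff_bounded)
  have "(\<integral>\<^sup>+ z. norm ((\<lambda>(s, p, q). e (s, p) * G p * cnj (e (s, q) * G q)) z) \<partial>(\<nu> \<Otimes>\<^sub>M (\<mu> \<Otimes>\<^sub>M \<mu>)))
     = (\<integral>\<^sup>+ s. \<integral>\<^sup>+ p. \<integral>\<^sup>+ q. norm (e (s, p) * G p * cnj (e (s, q) * G q)) \<partial>\<mu> \<partial>\<mu> \<partial>\<nu>)"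
  proof (subst mm.P.nn_integral_fst[symmetric], measurable, rule nn_integral_cong)
    fix s assume [measurable]: "s \<in> space \<nu>"
    show "(\<integral>\<^sup>+ y. norm (case (s, y) of (s, p, q) \<Rightarrow> e (s, p) * G p * cnj (e (s, q) * G q)) \<partial>(\<mu> \<Otimes>\<^sub>M \<mu>))
        = (\<integral>\<^sup>+ p. \<integral>\<^sup>+ q. norm (e (s, p) * G p * cnj (e (s, q) * G q)) \<partial>\<mu> \<partial>\<mu>)"
      by (subst \<mu>.nn_integral_fst[symmetric]) simp_all
  qed
  also have "\<dots> \<le> (\<integral>\<^sup>+ s. \<integral>\<^sup>+ p. \<integral>\<^sup>+ q. ennreal (norm (G p)) * ennreal (norm (G q)) \<partial>\<mu> \<partial>\<mu> \<partial>\<nu>)"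
  proof (intro nn_integral_mono)
    fix s p q
    have "norm (e (s, p) * G p * cnj (e (s, q) * G q))
        = (norm (e (s, p)) * norm (e (s,q))) * (norm (G p) * norm (G q))"
      by (simp add: norm_mult)
    also have "\<dots> \<le> 1 * (norm (G p) * norm (G q))"
      by (intro mult_right_mono mult_le_one e1) auto
    finally show "ennreal (norm (e (s, p) * G p * cnj (e (s, q) * G q))) \<le> ennreal (norm (G p)) * ennreal (norm (G q))"
      by (simp flip: ennreal_mult)
  qed
  also have "\<dots> = (\<integral>\<^sup>+ p. norm (G p) \<partial>\<mu>) * (\<integral>\<^sup>+ p. norm (G p) \<partial>\<mu>)"
    by (simp add: nn_integral_cmult nn_integral_multc \<nu>.emeasure_space_1)
  also have "\<dots> < \<infinity>" using fin by (simp add: ennreal_mult_less_top)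
  finally show ?thesis
    by (simp add: integrable_iff_bounded)
qed

text \<open>Write the squared modulus of \<open>U s\<close> as a double integral over
  \<open>(p, q)\<close> and integrate in s first. The exact identity is kept apart from Schur's test
  because the lower bound in Plancherel and Parseval on the torus are read off from it as
  well.\<close>

lemma TTstar_identity:
  fixes e :: "'s \<times> 'p \<Rightarrow> complex" and G :: "'p \<Rightarrow> complex"
  assumes \<mu>: "sigma_finite_measure \<mu>" and \<nu>: "prob_space \<nu>"
    and e[measurable]: "e \<in> borel_measurable (\<nu> \<Otimes>\<^sub>M \<mu>)" and e1: "\<And>z. norm (e z) \<le> 1"
    and G: "integrable \<mu> G"
  defines "U \<equiv> \<lambda>s. \<integral>p. e (s, p) * G p \<partial>\<mu>"
    and "\<kappa> \<equiv> \<lambda>p q. \<integral>s. e (s, p) * cnj (e (s, q)) \<partial>\<nu>"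
  shows "integrable (\<mu> \<Otimes>\<^sub>M \<mu>) (\<lambda>(p, q). G p * cnj (G q) * \<kappa> p q)"
    and "(\<integral>\<^sup>+ s. ennreal (norm (U s) ^ 2) \<partial>\<nu>)
       = ennreal (Re (\<integral>z. (case z of (p, q) \<Rightarrow> G p * cnj (G q) * \<kappa> p q) \<partial>(\<mu> \<Otimes>\<^sub>M \<mu>)))"
proof -
  interpret \<mu>: sigma_finite_measure \<mu> by fact
  interpret \<nu>: prob_space \<nu> by fact
  interpret mm: pair_sigma_finite \<mu> \<mu> ..
  interpret nmm: pair_sigma_finite \<nu> "\<mu> \<Otimes>\<^sub>M \<mu>" ..
  have [measurable]: "G \<in> borel_measurable \<mu>" using G by auto
  note int = TTstar_integrable[OF \<mu> \<nu> e e1 G]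
  define H where "H = (\<lambda>s p q. e (s, p) * G p * cnj (e (s, q) * G q))"
  have intH: "integrable (\<nu> \<Otimes>\<^sub>M (\<mu> \<Otimes>\<^sub>M \<mu>)) (\<lambda>(s, z). H s (fst z) (snd z))"
    using int by (simp add: H_def split_beta')
  have \<kappa>: "(\<integral>s. H s p q \<partial>\<nu>) = G p * cnj (G q) * \<kappa> p q" for p q
  proof -
    have "H s p q = G p * cnj (G q) * (e (s, p) * cnj (e (s, q)))" for s
      by (simp add: H_def)
    then show ?thesis by (simp add: \<kappa>_def)
  qed
  show "integrable (\<mu> \<Otimes>\<^sub>M \<mu>) (\<lambda>(p, q). G p * cnj (G q) * \<kappa> p q)"
    using nmm.integrable_snd[OF intH] by (simp add: \<kappa> split_beta')
  \<comment> \<open>Fubini supplies integrable slices only for almost every s, which is enough under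
    the integral.\<close>
  have sq: "AE s in \<nu>. (\<integral>z. H s (fst z) (snd z) \<partial>(\<mu> \<Otimes>\<^sub>M \<mu>)) = complex_of_real (norm (U s) ^ 2)"
    using nmm.AE_integrable_fst[OF intH]
  proof eventually_elim
    case (elim s)
    have "(\<integral>z. H s (fst z) (snd z) \<partial>(\<mu> \<Otimes>\<^sub>M \<mu>)) = (\<integral>p. \<integral>q. H s p q \<partial>\<mu> \<partial>\<mu>)"
      using mm.integral_fst'[OF elim] by simp
    also have "\<dots> = (\<integral>p. e (s,p) * G p * (\<integral>q. cnj (e (s, q) * G q) \<partial>\<mu>) \<partial>\<mu>)"
      unfolding H_def by (simp only: integral_mult_right_zero)
    also have "\<dots> = U s * cnj (U s)"
      by (simp add: U_def del: complex_cnj_mult)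
    finally show ?case by (simp only: complex_norm_square)
  qed
  have Um: "U \<in> borel_measurable \<nu>" unfolding U_def by measurable
  have I1: "integrable \<nu> (\<lambda>s. \<integral>z. H s (fst z) (snd z) \<partial>(\<mu> \<Otimes>\<^sub>M \<mu>))"
    by (rule nmm.integrable_fst[OF intH])
  then have "integrable \<nu> (\<lambda>s. complex_of_real (norm (U s) ^ 2))"
    by (rule integrable_cong_AE_imp) (use sq Um in auto)
  then have I2: "integrable \<nu> (\<lambda>s. norm (U s) ^ 2)"
    by (drule_tac integrable_Re) (simp only: Re_complex_of_real)
  have "(\<integral>s. complex_of_real (norm (U s) ^ 2) \<partial>\<nu>) = (\<integral>s. (\<integral>z. H s (fst z) (snd z) \<partial>(\<mu> \<Otimes>\<^sub>M \<mu>)) \<partial>\<nu>)"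
    by (rule integral_cong_AE) (use sq Um I1 in auto)
  also have "\<dots> = (\<integral>z. (\<integral>s. H s (fst z) (snd z) \<partial>\<nu>) \<partial>(\<mu> \<Otimes>\<^sub>M \<mu>))"
    using nmm.integral_fst[OF intH] nmm.integral_snd[OF intH] by simp
  also have "\<dots> = (\<integral>z. (case z of (p, q) \<Rightarrow> G p * cnj (G q) * \<kappa> p q) \<partial>(\<mu> \<Otimes>\<^sub>M \<mu>))"
    by (simp add: \<kappa> split_beta')
  finally have "(\<integral>s. norm (U s) ^ 2 \<partial>\<nu>) = Re (\<integral>z. (case z of (p, q) \<Rightarrow> G p * cnj (G q) * \<kappa> p q) \<partial>(\<mu> \<Otimes>\<^sub>M \<mu>))"
    by (metis Re_complex_of_real integral_complex_of_real)
  then show "(\<integral>\<^sup>+ s. ennreal (norm (U s) ^ 2) \<partial>\<nu>)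
       = ennreal (Re (\<integral>z. (case z of (p, q) \<Rightarrow> G p * cnj (G q) * \<kappa> p q) \<partial>(\<mu> \<Otimes>\<^sub>M \<mu>)))"
    using nn_integral_eq_integral[OF I2] by simp
qed

text \<open>Schur's test by way of 2|G p||G q| \<le> |G p|^2 + |G q|^2. In each half one variable
  occurs only in the kernel, and integrating it out leaves a row integral, at most \<open>A\<close>.
  Symmetry of the majorant makes the two halves equal, so no separate bound on columns
  enters.\<close>

lemma TTstar_Schur:
  fixes e :: "'s \<times> 'p \<Rightarrow> complex" and G :: "'p \<Rightarrow> complex" and \<kappa> :: "'p \<Rightarrow> 'p \<Rightarrow> real"
  assumes \<mu>: "sigma_finite_measure \<mu>" and \<nu>: "prob_space \<nu>"
    and e[measurable]: "e \<in> borel_measurable (\<nu> \<Otimes>\<^sub>M \<mu>)" and e1: "\<And>z. norm (e z) \<le> 1"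
    and G: "integrable \<mu> G"
    and \<kappa>[measurable]: "case_prod \<kappa> \<in> borel_measurable (\<mu> \<Otimes>\<^sub>M \<mu>)"
    and bound: "\<And>p q. norm (\<integral>s. e (s, p) * cnj (e (s, q)) \<partial>\<nu>) \<le> \<kappa> p q"
    and sym: "\<And>p q. \<kappa> p q = \<kappa> q p"
    and A: "\<And>p. (\<integral>\<^sup>+ q. ennreal (\<kappa> p q) \<partial>\<mu>) \<le> A"
  shows "(\<integral>\<^sup>+ s. ennreal (norm (\<integral>p. e (s, p) * G p \<partial>\<mu>) ^ 2) \<partial>\<nu>)
           \<le> A * (\<integral>\<^sup>+ p. ennreal (norm (G p) ^ 2) \<partial>\<mu>)"
proof -
  interpret \<mu>: sigma_finite_measure \<mu> by fact
  interpret mm: pair_sigma_finite \<mu> \<mu> ..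
  have [measurable]: "G \<in> borel_measurable \<mu>" using G by auto
  define k where "k = (\<lambda>p q. \<integral>s. e (s, p) * cnj (e (s, q)) \<partial>\<nu>)"
  define B where "B = (\<lambda>z. case z of (p, q) \<Rightarrow> G p * cnj (G q) * k p q)"
  have k: "norm (k p q) \<le> \<kappa> p q" for p q using bound by (simp add: k_def)
  have k0: "0 \<le> \<kappa> p q" for p q using k[of p q] norm_ge_zero order_trans by blast
  have intB: "integrable (\<mu> \<Otimes>\<^sub>M \<mu>) B"
    using TTstar_identity(1)[OF \<mu> \<nu> e e1 G] by (simp add: k_def B_def)
  have "(\<integral>\<^sup>+ s. ennreal (norm (\<integral>p. e (s, p) * G p \<partial>\<mu>) ^ 2) \<partial>\<nu>) = ennreal (Re (integral\<^sup>L (\<mu> \<Otimes>\<^sub>M \<mu>) B))"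
    using TTstar_identity(2)[OF \<mu> \<nu> e e1 G] by (simp add: k_def B_def)
  also have "\<dots> \<le> ennreal (norm (integral\<^sup>L (\<mu> \<Otimes>\<^sub>M \<mu>) B))"
    by (simp add: complex_Re_le_cmod ennreal_leI)
  also have "\<dots> \<le> (\<integral>\<^sup>+ z. ennreal (norm (B z)) \<partial>(\<mu> \<Otimes>\<^sub>M \<mu>))"
    by (rule integral_norm_bound_ennreal[OF intB])
  also have "\<dots> = (\<integral>\<^sup>+ p. \<integral>\<^sup>+ q. ennreal (norm (B (p, q))) \<partial>\<mu> \<partial>\<mu>)"
    by (rule \<mu>.nn_integral_fst[symmetric]) (use intB in measurable)
  also have "\<dots> \<le> (\<integral>\<^sup>+ p. \<integral>\<^sup>+ q. ennreal (norm (G p) ^ 2 / 2) * ennreal (\<kappa> p q)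
       + ennreal (norm (G q) ^ 2 / 2) * ennreal (\<kappa> p q) \<partial>\<mu> \<partial>\<mu>)"
  proof (intro nn_integral_mono)
    fix p q
    have "norm (B (p, q)) \<le> (norm (G p) * norm (G q)) * \<kappa> p q"
      unfolding B_def by (simp add: norm_mult mult_left_mono k)
    also have "\<dots> \<le> (norm (G p) ^ 2 / 2 + norm (G q) ^ 2 / 2) * \<kappa> p q"
      by (intro mult_right_mono k0) (use sum_squares_bound[of "norm (G p)" "norm (G q)"] in simp)
    also have "\<dots> = norm (G p) ^ 2 / 2 * \<kappa> p q + norm (G q) ^ 2 / 2 * \<kappa> p q"
      by (simp add: distrib_right)
    finally have "ennreal (norm (B (p, q))) \<le> ennreal (norm (G p) ^ 2 / 2 * \<kappa> p q + norm (G q) ^ 2 / 2 * \<kappa> p q)"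
      by (rule ennreal_leI)
    also have "\<dots> = ennreal (norm (G p) ^ 2 / 2) * ennreal (\<kappa> p q)
       + ennreal (norm (G q) ^ 2 / 2) * ennreal (\<kappa> p q)"
      by (simp add: k0 ennreal_mult[symmetric] ennreal_plus[symmetric] del: ennreal_plus)
    finally show "ennreal (norm (B (p, q))) \<le> ennreal (norm (G p) ^ 2 / 2) * ennreal (\<kappa> p q)
       + ennreal (norm (G q) ^ 2 / 2) * ennreal (\<kappa> p q)" .
  qed
  also have "\<dots> = (\<integral>\<^sup>+ p. \<integral>\<^sup>+ q. ennreal (norm (G p) ^ 2 / 2) * ennreal (\<kappa> p q) \<partial>\<mu> \<partial>\<mu>)
      + (\<integral>\<^sup>+ p. \<integral>\<^sup>+ q. ennreal (norm (G q) ^ 2 / 2) * ennreal (\<kappa> p q) \<partial>\<mu> \<partial>\<mu>)"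
    by (subst nn_integral_add[symmetric]) (auto intro!: nn_integral_cong nn_integral_add)
  \<comment> \<open>The second half has G in the inner variable; exchanging the order and using the
    symmetry of \<kappa> turns it into the first.\<close>
  also have "(\<integral>\<^sup>+ p. \<integral>\<^sup>+ q. ennreal (norm (G q) ^ 2 / 2) * ennreal (\<kappa> p q) \<partial>\<mu> \<partial>\<mu>)
      = (\<integral>\<^sup>+ q. \<integral>\<^sup>+ p. ennreal (norm (G q) ^ 2 / 2) * ennreal (\<kappa> p q) \<partial>\<mu> \<partial>\<mu>)"
    by (rule mm.Fubini'[symmetric]) measurable
  also have "\<dots> = (\<integral>\<^sup>+ p. \<integral>\<^sup>+ q. ennreal (norm (G p) ^ 2 / 2) * ennreal (\<kappa> p q) \<partial>\<mu> \<partial>\<mu>)"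
    by (subst sym) simp
  also have "(\<integral>\<^sup>+ p. \<integral>\<^sup>+ q. ennreal (norm (G p) ^ 2 / 2) * ennreal (\<kappa> p q) \<partial>\<mu> \<partial>\<mu>) \<le>
      (\<integral>\<^sup>+ p. ennreal (norm (G p) ^ 2 / 2) * A \<partial>\<mu>)"
    by (intro nn_integral_mono) (simp add: nn_integral_cmult A mult_left_mono)
  finally have "(\<integral>\<^sup>+ s. ennreal (norm (\<integral>p. e (s, p) * G p \<partial>\<mu>) ^ 2) \<partial>\<nu>)
     \<le> (\<integral>\<^sup>+ p. ennreal (norm (G p) ^ 2 / 2) * A \<partial>\<mu>) + (\<integral>\<^sup>+ p. ennreal (norm (G p) ^ 2 / 2) * A \<partial>\<mu>)"
    by (meson add_mono order_trans order_refl)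
  also have "\<dots> = (\<integral>\<^sup>+ p. ennreal (norm (G p) ^ 2 / 2) * A + ennreal (norm (G p) ^ 2 / 2) * A \<partial>\<mu>)"
    by (rule nn_integral_add[symmetric]) measurable
  also have "\<dots> = (\<integral>\<^sup>+ p. A * ennreal (norm (G p) ^ 2) \<partial>\<mu>)"
    by (intro nn_integral_cong)
       (simp add: mult.commute[of A] flip: distrib_right ennreal_plus del: ennreal_plus)
  also have "\<dots> = A * (\<integral>\<^sup>+ p. ennreal (norm (G p) ^ 2) \<partial>\<mu>)"
    by (rule nn_integral_cmult) measurable
  finally show ?thesis .
qed

lemma integral_std_normal_cis:
  "(\<integral>x. cis (\<theta> * x) \<partial>std_normal_distribution) = complex_of_real (exp (- (\<theta>\<^sup>2) / 2))"
  using fun_cong[OF char_std_normal_distribution, of \<theta>] by (simp add: char_def cis_conv_exp)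

subsection \<open>Gaussian weights and the inverse Fourier transform\<close>

lemma nn_integral_gauss:
  assumes "c > 0"
  shows "(\<integral>\<^sup>+ \<eta>. ennreal (exp (- ((c * (\<xi> - \<eta>))\<^sup>2) / 2)) \<partial>lborel) = ennreal (sqrt (2 * pi) / c)"
proof -
  \<comment> \<open>A Gaussian in \<eta> with mean \<xi> and standard deviation 1/c, so its integral
    is that of a probability density.\<close>
  have eq: "exp (- ((c * (\<xi> - \<eta>))\<^sup>2) / 2) = sqrt (2 * pi) / c * normal_density \<xi> (1 / c) \<eta>" for \<eta>
    using assms by (simp add: normal_density_def field_simps real_sqrt_divide real_sqrt_mult power2_commute)
       (simp add: power2_eq_square algebra_simps)
  have "(\<integral>\<^sup>+ \<eta>. ennreal (exp (- ((c * (\<xi> - \<eta>))\<^sup>2) / 2)) \<partial>lborel)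
      = (\<integral>\<^sup>+ \<eta>. ennreal (sqrt (2 * pi) / c) * ennreal (normal_density \<xi> (1 / c) \<eta>) \<partial>lborel)"
    unfolding eq using assms by (subst ennreal_mult[symmetric]) auto
  also have "\<dots> = ennreal (sqrt (2 * pi) / c) * (\<integral>\<^sup>+ \<eta>. ennreal (normal_density \<xi> (1 / c) \<eta>) \<partial>lborel)"
    by (rule nn_integral_cmult) measurable
  also have "(\<integral>\<^sup>+ \<eta>. ennreal (normal_density \<xi> (1 / c) \<eta>) \<partial>lborel) = 1"
    using assms by (subst nn_integral_eq_integral) auto
  finally show ?thesis by simp
qed

text \<open>The prefactor undoes the normalisation of the density, so that the weight on the right
  has maximum 1 and tends to 1, not to 0, as \<sigma> grows.\<close>

lemma nn_integral_std_normal_scale: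
  fixes f :: "real \<Rightarrow> ennreal"
  assumes [measurable]: "f \<in> borel_measurable borel" and \<sigma>: "\<sigma> > 0"
  shows "ennreal (\<sigma> * sqrt (2 * pi)) * (\<integral>\<^sup>+ x. f (\<sigma> * x) \<partial>std_normal_distribution)
       = (\<integral>\<^sup>+ x. ennreal (exp (- ((x / \<sigma>)\<^sup>2) / 2)) * f x \<partial>lborel)"
proof -
  have "(\<integral>\<^sup>+ x. ennreal (exp (- ((x / \<sigma>)\<^sup>2) / 2)) * f x \<partial>lborel)
      = \<sigma> * (\<integral>\<^sup>+ x. ennreal (exp (- (x\<^sup>2) / 2)) * f (\<sigma> * x) \<partial>lborel)"
    using \<sigma> by (subst nn_integral_real_affine[where c = \<sigma> and t = 0]) auto
  also have "(\<integral>\<^sup>+ x. ennreal (exp (- (x\<^sup>2) / 2)) * f (\<sigma> * x) \<partial>lborel)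
      = (\<integral>\<^sup>+ x. ennreal (sqrt (2 * pi)) * (ennreal (std_normal_density x) * f (\<sigma> * x)) \<partial>lborel)"
    by (intro nn_integral_cong)
       (simp add: std_normal_density_def mult.assoc[symmetric] flip: ennreal_mult)
  also have "\<dots> = ennreal (sqrt (2 * pi)) * (\<integral>\<^sup>+ x. f (\<sigma> * x) \<partial>std_normal_distribution)"
    by (simp add: nn_integral_cmult nn_integral_density)
  finally show ?thesis using \<sigma> by (simp add: ennreal_mult mult.assoc)
qed

lemma nn_integral_std_normal_scale_le:
  fixes f :: "real \<Rightarrow> ennreal"
  assumes [measurable]: "f \<in> borel_measurable borel" and \<sigma>: "\<sigma> > 0"
  shows "ennreal (\<sigma> * sqrt (2 * pi)) * (\<integral>\<^sup>+ x. f (\<sigma> * x) \<partial>std_normal_distribution)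
       \<le> (\<integral>\<^sup>+ x. f x \<partial>lborel)"
  unfolding nn_integral_std_normal_scale[OF assms]
proof (intro nn_integral_mono)
  fix x
  have "ennreal (exp (- ((x / \<sigma>)\<^sup>2) / 2)) \<le> 1" by (simp add: ennreal_le_1)
  then show "ennreal (exp (- ((x / \<sigma>)\<^sup>2) / 2)) * f x \<le> f x"
    using mult_right_mono[of _ 1 "f x"] by simp
qed

text \<open>This is how Lebesgue measure on the line is reached from probability measures: a bound
  uniform in the width passes to the limit by Fatou's lemma along the widths
  \<open>Suc n\<close>.\<close>

lemma nn_integral_le_std_normal_scale:
  fixes f :: "real \<Rightarrow> ennreal"
  assumes [measurable]: "f \<in> borel_measurable borel"
    and B: "\<And>\<sigma>. \<sigma> > 0 \<Longrightarrow> ennreal (\<sigma> * sqrt (2 * pi)) * (\<integral>\<^sup>+ x. f (\<sigma> * x) \<partial>std_normal_distribution) \<le> B"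
  shows "(\<integral>\<^sup>+ x. f x \<partial>lborel) \<le> B"
proof -
  define u where "u = (\<lambda>n x. ennreal (exp (- ((x / real (Suc n))\<^sup>2) / 2)) * f x)"
  have lim: "(\<lambda>n. u n x) \<longlonglongrightarrow> f x" for x
  proof -
    have "(\<lambda>n. x * inverse (real (Suc n))) \<longlonglongrightarrow> x * 0"
      by (intro tendsto_mult tendsto_const LIMSEQ_inverse_real_of_nat)
    then have "(\<lambda>n. x / real (Suc n)) \<longlonglongrightarrow> 0"
      by (simp add: divide_inverse)
    then have "(\<lambda>n. exp (- ((x / real (Suc n))\<^sup>2) / 2)) \<longlonglongrightarrow> exp (- (0\<^sup>2) / 2)"
      by (intro tendsto_intros) auto
    then have "(\<lambda>n. ennreal (exp (- ((x / real (Suc n))\<^sup>2) / 2))) \<longlonglongrightarrow> 1"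
      by (subst ennreal_1[symmetric], intro tendsto_ennrealI) simp
    then have "(\<lambda>n. u n x) \<longlonglongrightarrow> 1 * f x"
      unfolding u_def by (rule tendsto_mult_ennreal) auto
    then show ?thesis by simp
  qed
  have "(\<integral>\<^sup>+ x. f x \<partial>lborel) = (\<integral>\<^sup>+ x. liminf (\<lambda>n. u n x) \<partial>lborel)"
    by (intro nn_integral_cong) (metis lim lim_imp_Liminf sequentially_bot)
  also have "\<dots> \<le> liminf (\<lambda>n. \<integral>\<^sup>+ x. u n x \<partial>lborel)"
    by (rule nn_integral_liminf) (simp add: u_def)
  also have "\<dots> \<le> B"
  proof (rule Liminf_le)
    show "\<forall>\<^sub>F n in sequentially. (\<integral>\<^sup>+ x. u n x \<partial>lborel) \<le> B"
      unfolding u_def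
      by (intro always_eventually allI)
         (subst nn_integral_std_normal_scale[symmetric], use B in auto)
  qed simp
  finally show ?thesis .
qed

section \<open>The inverse Fourier transform and Bessel's inequality\<close>

definition inv_fourier :: "(real \<Rightarrow> complex) \<Rightarrow> real \<Rightarrow> complex" where
  "inv_fourier f x = (\<integral>\<xi>. cis (2 * pi * (\<xi> * x)) * f \<xi> \<partial>lborel)"

lemma borel_measurable_cis [measurable]: "cis \<in> borel_measurable borel"
  by (intro borel_measurable_continuous_onI continuous_intros)

lemma borel_measurable_inv_fourier [measurable]:
  assumes [measurable]: "f \<in> borel_measurable borel"
  shows "inv_fourier f \<in> borel_measurable borel"
  unfolding inv_fourier_def by measurable

lemma prob_space_std_normal: "prob_space std_normal_distribution"
  by (rule prob_space_normal_density) simp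

lemma cis_mult_cnj: "cis a * cnj (cis b) = cis (a - b)"
  by (simp add: cis_cnj cis_mult)

lemma gauss_kernel:
  "(\<integral>x. cis (2 * pi * (\<xi> * (\<sigma> * x))) * cnj (cis (2 * pi * (\<eta> * (\<sigma> * x)))) \<partial>std_normal_distribution)
     = complex_of_real (exp (- ((2 * pi * \<sigma> * (\<xi> - \<eta>))\<^sup>2) / 2))"
proof -
  have "cis (2 * pi * (\<xi> * (\<sigma> * x))) * cnj (cis (2 * pi * (\<eta> * (\<sigma> * x)))) = cis ((2 * pi * \<sigma> * (\<xi> - \<eta>)) * x)" for x
    unfolding cis_mult_cnj by (simp add: algebra_simps)
  then show ?thesis using integral_std_normal_cis[of "2 * pi * \<sigma> * (\<xi> - \<eta>)"] by simp
qed

text \<open>The row integral of the Gaussian kernel is exactly the reciprocal of the normalising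
  factor, so Schur's test gives constant 1 at every width. The bound serves to control approximation
  errors in \<open>plancherel_ge_closed\<close>.\<close>

lemma inv_fourier_bessel:
  assumes f: "integrable lborel f"
  shows "(\<integral>\<^sup>+ x. ennreal (norm (inv_fourier f x) ^ 2) \<partial>lborel) \<le> (\<integral>\<^sup>+ \<xi>. ennreal (norm (f \<xi>) ^ 2) \<partial>lborel)"
proof (rule nn_integral_le_std_normal_scale)
  have [measurable]: "f \<in> borel_measurable borel" using f by auto
  show "(\<lambda>x. ennreal (norm (inv_fourier f x) ^ 2)) \<in> borel_measurable borel" by measurable
  fix \<sigma> :: real assume \<sigma>: "\<sigma> > 0"
  have "(\<integral>\<^sup>+ x. ennreal (norm (\<integral>\<xi>. (\<lambda>(x, \<xi>). cis (2 * pi * (\<xi> * (\<sigma> * x)))) (x, \<xi>) * f \<xi> \<partial>lborel) ^ 2) \<partial>std_normal_distribution)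
      \<le> ennreal (1 / (\<sigma> * sqrt (2 * pi))) * (\<integral>\<^sup>+ \<xi>. ennreal (norm (f \<xi>) ^ 2) \<partial>lborel)"
  proof (rule TTstar_Schur[where \<kappa> = "\<lambda>\<xi> \<eta>. exp (- ((2 * pi * \<sigma> * (\<xi> - \<eta>))\<^sup>2) / 2)"])
    show "sigma_finite_measure lborel" by (rule lborel.sigma_finite_measure_axioms)
    show "prob_space std_normal_distribution" by (rule prob_space_std_normal)
    show "(\<integral>\<^sup>+ \<eta>. ennreal (exp (- ((2 * pi * \<sigma> * (\<xi> - \<eta>))\<^sup>2) / 2)) \<partial>lborel) \<le> ennreal (1 / (\<sigma> * sqrt (2 * pi)))" for \<xi>
    proof -
      have "sqrt (2 * pi) / (2 * pi * \<sigma>) = 1 / (\<sigma> * sqrt (2 * pi))"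
        using \<sigma> by (simp add: divide_simps)
      then show ?thesis using nn_integral_gauss[of "2 * pi * \<sigma>" \<xi>] \<sigma> by simp
    qed
    show "norm (\<integral>s. (\<lambda>(x, \<xi>). cis (2 * pi * (\<xi> * (\<sigma> * x)))) (s, \<xi>) *
        cnj ((\<lambda>(x, \<xi>). cis (2 * pi * (\<xi> * (\<sigma> * x)))) (s, \<eta>)) \<partial>std_normal_distribution)
        \<le> exp (- ((2 * pi * \<sigma> * (\<xi> - \<eta>))\<^sup>2) / 2)" for \<xi> \<eta>
      by (simp only: prod.case gauss_kernel) simp
  qed (use f in \<open>auto simp: power2_commute power_mult_distrib\<close>)
  then have "(\<integral>\<^sup>+ x. ennreal (norm (inv_fourier f (\<sigma> * x)) ^ 2) \<partial>std_normal_distribution)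
      \<le> ennreal (1 / (\<sigma> * sqrt (2 * pi))) * (\<integral>\<^sup>+ \<xi>. ennreal (norm (f \<xi>) ^ 2) \<partial>lborel)"
    by (simp add: inv_fourier_def)
  then have "ennreal (\<sigma> * sqrt (2 * pi)) * (\<integral>\<^sup>+ x. ennreal (norm (inv_fourier f (\<sigma> * x)) ^ 2) \<partial>std_normal_distribution)
      \<le> ennreal (\<sigma> * sqrt (2 * pi)) * (ennreal (1 / (\<sigma> * sqrt (2 * pi))) * (\<integral>\<^sup>+ \<xi>. ennreal (norm (f \<xi>) ^ 2) \<partial>lborel))"
    by (rule mult_left_mono) simp
  also have "\<dots> = (\<integral>\<^sup>+ \<xi>. ennreal (norm (f \<xi>) ^ 2) \<partial>lborel)"
    using \<sigma> by (simp add: mult.assoc[symmetric] flip: ennreal_mult)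
  finally show "ennreal (\<sigma> * sqrt (2 * pi)) * (\<integral>\<^sup>+ x. ennreal (norm (inv_fourier f (\<sigma> * x)) ^ 2) \<partial>std_normal_distribution)
      \<le> (\<integral>\<^sup>+ \<xi>. ennreal (norm (f \<xi>) ^ 2) \<partial>lborel)" .
qed

subsection \<open>Plancherel\<close>

lemma integrable_bounded_support:
  fixes h :: "real \<Rightarrow> 'a::{banach, second_countable_topology}"
  assumes [measurable]: "h \<in> borel_measurable borel"
    and B: "\<And>x. norm (h x) \<le> B" and R: "\<And>x. \<bar>x\<bar> > R \<Longrightarrow> h x = 0"
  shows "integrable lborel h"
proof (rule Bochner_Integration.integrable_bound)
  show "integrable lborel (\<lambda>x. B * indicator {-R..R} x :: real)"
    by (intro integrable_mult_right integrable_real_indicator) (auto simp: emeasure_lborel_Icc_eq)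
  show "AE x in lborel. norm (h x) \<le> norm (B * indicator {-R..R} x :: real)"
  proof (rule AE_I2)
    fix x
    have "0 \<le> B" using order_trans[OF norm_ge_zero B] .
    then show "norm (h x) \<le> norm (B * indicator {-R..R} x :: real)"
      using B[of x] R[of x] by (cases "\<bar>x\<bar> > R") (auto simp: indicator_def abs_le_iff)
  qed
qed simp

text \<open>Weighting the physical side by a Gaussian of height 1 can only decrease it, and by the
  TT* identity the weighted integral equals the pairing of \<open>h\<close> with a mollification of
  \<open>cnj h\<close>. The mollification converges at points of continuity, hence almost
  everywhere. Jumps at R and -R are allowed because the approximants used later are continuous
  functions cut off to the interval between -R and R.\<close>

lemma plancherel_ge_nice:
  fixes h :: "real \<Rightarrow> complex"
  assumes h[measurable]: "h \<in> borel_measurable borel"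
    and B: "\<And>x. norm (h x) \<le> B" and R: "\<And>x. \<bar>x\<bar> > R \<Longrightarrow> h x = 0"
    and cont: "\<And>x. \<bar>x\<bar> \<noteq> R \<Longrightarrow> isCont h x"
  shows "(\<integral>\<^sup>+ \<xi>. ennreal (norm (h \<xi>) ^ 2) \<partial>lborel) \<le> (\<integral>\<^sup>+ x. ennreal (norm (inv_fourier h x) ^ 2) \<partial>lborel)"
    (is "?L \<le> ?R")
proof -
  have inth: "integrable lborel h" by (rule integrable_bounded_support[OF h B R])
  have B0: "0 \<le> B" using order_trans[OF norm_ge_zero B] .
  interpret N: prob_space std_normal_distribution by (rule prob_space_std_normal)
  \<comment> \<open>The mollification of \<open>cnj h\<close>. Its scale
    \<open>1 / (2 * pi * real (Suc n))\<close> is the width of the kernel exp(-(2 pi \<sigma> (\<xi>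
    - \<eta>))^2 / 2) at \<sigma> = \<open>Suc n\<close>.\<close>
  define I where "I = (\<lambda>n \<xi>. \<integral>s. cnj (h (\<xi> - s / (2 * pi * real (Suc n)))) \<partial>std_normal_distribution)"
  have I[measurable]: "I n \<in> borel_measurable borel" for n unfolding I_def by measurable
  have I_B: "norm (I n \<xi>) \<le> B" for n \<xi>
  proof -
    have "norm (I n \<xi>) \<le> (\<integral>s. norm (cnj (h (\<xi> - s / (2 * pi * real (Suc n))))) \<partial>std_normal_distribution)"
      unfolding I_def by (rule integral_norm_bound)
    also have "\<dots> \<le> (\<integral>s. B \<partial>std_normal_distribution)"
      by (intro integral_mono N.integrable_const_bound[where B=B]) (auto simp: B B0)
    finally have "norm (I n \<xi>) \<le> (\<integral>s. B \<partial>std_normal_distribution)" .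
    then show ?thesis using N.prob_space by simp
  qed
  have I_lim: "(\<lambda>n. I n \<xi>) \<longlonglongrightarrow> cnj (h \<xi>)" if "\<bar>\<xi>\<bar> \<noteq> R" for \<xi>
  proof -
    have "(\<lambda>n. I n \<xi>) \<longlonglongrightarrow> (\<integral>s. cnj (h \<xi>) \<partial>std_normal_distribution)"
      unfolding I_def
    proof (rule integral_dominated_convergence[where w = "\<lambda>_. B"])
      show "AE s in std_normal_distribution. (\<lambda>n. cnj (h (\<xi> - s / (2 * pi * real (Suc n))))) \<longlonglongrightarrow> cnj (h \<xi>)"
      proof (rule AE_I2)
        fix s
        have "(\<lambda>n. \<xi> - s / (2 * pi) * inverse (real (Suc n))) \<longlonglongrightarrow> \<xi> - s / (2 * pi) * 0"
          by (intro tendsto_intros LIMSEQ_inverse_real_of_nat)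
        then have "(\<lambda>n. \<xi> - s / (2 * pi * real (Suc n))) \<longlonglongrightarrow> \<xi>"
          by (simp only: divide_inverse inverse_mult_distrib mult.assoc mult_zero_right diff_zero)
        then have "(\<lambda>n. h (\<xi> - s / (2 * pi * real (Suc n)))) \<longlonglongrightarrow> h \<xi>"
          by (rule isCont_tendsto_compose[OF cont[OF that]])
        then show "(\<lambda>n. cnj (h (\<xi> - s / (2 * pi * real (Suc n))))) \<longlonglongrightarrow> cnj (h \<xi>)"
          by (rule tendsto_cnj)
      qed
    qed (auto simp: B)
    then show ?thesis using N.prob_space by simp
  qed
  have lim: "(\<lambda>n. \<integral>\<xi>. h \<xi> * I n \<xi> \<partial>lborel) \<longlonglongrightarrow> (\<integral>\<xi>. h \<xi> * cnj (h \<xi>) \<partial>lborel)"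
  proof (rule integral_dominated_convergence[where w = "\<lambda>\<xi>. norm (h \<xi>) * B"])
    have "AE \<xi> in lborel. \<xi> \<noteq> R" "AE \<xi> in lborel. \<xi> \<noteq> -R"
      by (auto intro: AE_lborel_singleton)
    then show "AE \<xi> in lborel. (\<lambda>n. h \<xi> * I n \<xi>) \<longlonglongrightarrow> h \<xi> * cnj (h \<xi>)"
    proof eventually_elim
      case (elim \<xi>)
      then have "\<bar>\<xi>\<bar> \<noteq> R" by auto
      then show ?case by (intro tendsto_intros I_lim)
    qed
  qed (use inth in \<open>auto simp: norm_mult intro!: mult_left_mono I_B\<close>)
  have sq: "(\<integral>\<xi>. h \<xi> * cnj (h \<xi>) \<partial>lborel) = complex_of_real (\<integral>\<xi>. norm (h \<xi>) ^ 2 \<partial>lborel)"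
    by (simp only: complex_norm_square[symmetric] integral_complex_of_real)
  have lim': "(\<lambda>n. ennreal (Re (\<integral>\<xi>. h \<xi> * I n \<xi> \<partial>lborel))) \<longlonglongrightarrow> ennreal (\<integral>\<xi>. norm (h \<xi>) ^ 2 \<partial>lborel)"
    using tendsto_Re[OF lim] unfolding sq by (intro tendsto_ennrealI) simp
  have int2: "integrable lborel (\<lambda>\<xi>. norm (h \<xi>) ^ 2)"
  proof (rule integrable_bounded_support[where B = "B^2" and R = R])
    show "norm (norm (h x) ^ 2) \<le> B ^ 2" for x using power_mono[OF B[of x], of 2] by simp
  qed (use R in auto)
  have "?L = ennreal (\<integral>\<xi>. norm (h \<xi>) ^ 2 \<partial>lborel)"
    by (rule nn_integral_eq_integral[OF int2]) simp
  also have "\<dots> \<le> ?R"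
  proof (rule LIMSEQ_le_const2[OF lim'], intro exI[of _ 0] allI impI)
    fix n
    define \<sigma> where "\<sigma> = real (Suc n)"
    have \<sigma>: "\<sigma> > 0" by (simp add: \<sigma>_def)
    define \<kappa> where "\<kappa> = (\<lambda>\<xi> \<eta>. complex_of_real (exp (- ((2 * pi * \<sigma> * (\<xi> - \<eta>))\<^sup>2) / 2)))"
    have m: "(\<lambda>(x, \<xi>). cis (2 * pi * (\<xi> * (\<sigma> * x)))) \<in> borel_measurable (std_normal_distribution \<Otimes>\<^sub>M lborel)"
      by measurable
    note TT = TTstar_identity[OF lborel.sigma_finite_measure_axioms prob_space_std_normal m _ inth, unfolded prod.case gauss_kernel]
    have intk: "integrable (lborel \<Otimes>\<^sub>M lborel) (\<lambda>(\<xi>, \<eta>). h \<xi> * cnj (h \<eta>) * \<kappa> \<xi> \<eta>)"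
      unfolding \<kappa>_def by (rule TT(1)) auto
    have id: "(\<integral>\<^sup>+ x. ennreal (norm (inv_fourier h (\<sigma> * x)) ^ 2) \<partial>std_normal_distribution)
       = ennreal (Re (\<integral>z. (case z of (\<xi>, \<eta>) \<Rightarrow> h \<xi> * cnj (h \<eta>) * \<kappa> \<xi> \<eta>) \<partial>(lborel \<Otimes>\<^sub>M lborel)))"
      unfolding \<kappa>_def inv_fourier_def by (rule TT(2)) auto
    \<comment> \<open>The substitution \<eta> = \<xi> - s/c with c = 2 pi \<sigma> makes the kernel
      a multiple sqrt(2 pi) of the standard normal density; with the Jacobian 1/c this leaves
      1/(\<sigma> sqrt(2 pi)).\<close>
    have inner: "(\<integral>\<eta>. h \<xi> * cnj (h \<eta>) * \<kappa> \<xi> \<eta> \<partial>lborel) = h \<xi> * I n \<xi> / complex_of_real (\<sigma> * sqrt (2 * pi))" for \<xi>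
    proof -
      define c where "c = 2 * pi * \<sigma>"
      have c: "c > 0" using \<sigma> by (simp add: c_def)
      have "(\<integral>\<eta>. cnj (h \<eta>) * \<kappa> \<xi> \<eta> \<partial>lborel)
          = \<bar>- 1 / c\<bar> *\<^sub>R (\<integral>s. cnj (h (\<xi> + (- 1 / c) * s)) * \<kappa> \<xi> (\<xi> + (- 1 / c) * s) \<partial>lborel)"
        by (rule lborel_integral_real_affine) (use c in auto)
      also have "(\<integral>s. cnj (h (\<xi> + (- 1 / c) * s)) * \<kappa> \<xi> (\<xi> + (- 1 / c) * s) \<partial>lborel)
          = (\<integral>s. complex_of_real (sqrt (2 * pi)) * (std_normal_density s *\<^sub>R cnj (h (\<xi> - s / c))) \<partial>lborel)"
      proof (rule Bochner_Integration.integral_cong[OF refl])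
        fix s
        have "\<kappa> \<xi> (\<xi> + (- 1 / c) * s) = complex_of_real (exp (- (s\<^sup>2) / 2))"
          unfolding \<kappa>_def c_def[symmetric] using c by simp
        also have "\<dots> = complex_of_real (sqrt (2 * pi)) * complex_of_real (std_normal_density s)"
          unfolding of_real_mult[symmetric] by (simp add: std_normal_density_def)
        finally show "cnj (h (\<xi> + (- 1 / c) * s)) * \<kappa> \<xi> (\<xi> + (- 1 / c) * s)
          = complex_of_real (sqrt (2 * pi)) * (std_normal_density s *\<^sub>R cnj (h (\<xi> - s / c)))"
          by (simp add: scaleR_conv_of_real mult_ac)
      qed
      also have "\<dots> = complex_of_real (sqrt (2 * pi)) * (\<integral>s. std_normal_density s *\<^sub>R cnj (h (\<xi> - s / c)) \<partial>lborel)"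
        by (rule integral_mult_right_zero)
      also have "(\<integral>s. std_normal_density s *\<^sub>R cnj (h (\<xi> - s / c)) \<partial>lborel) = I n \<xi>"
        unfolding I_def c_def \<sigma>_def by (subst integral_density) auto
      finally have "(\<integral>\<eta>. cnj (h \<eta>) * \<kappa> \<xi> \<eta> \<partial>lborel) = \<bar>- 1 / c\<bar> *\<^sub>R (complex_of_real (sqrt (2 * pi)) * I n \<xi>)" .
      also have "\<dots> = complex_of_real (sqrt (2 * pi) / c) * I n \<xi>"
        using c by (simp add: scaleR_conv_of_real)
      also have "sqrt (2 * pi) / c = 1 / (\<sigma> * sqrt (2 * pi))"
        using \<sigma> by (simp add: c_def divide_simps)
      finally show ?thesis by (simp add: mult.assoc)
    qed
    have "(\<integral>z. (case z of (\<xi>, \<eta>) \<Rightarrow> h \<xi> * cnj (h \<eta>) * \<kappa> \<xi> \<eta>) \<partial>(lborel \<Otimes>\<^sub>M lborel))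
        = (\<integral>\<xi>. \<integral>\<eta>. h \<xi> * cnj (h \<eta>) * \<kappa> \<xi> \<eta> \<partial>lborel \<partial>lborel)"
      using lborel_pair.integral_fst[OF intk] by simp
    also have "\<dots> = (\<integral>\<xi>. h \<xi> * I n \<xi> \<partial>lborel) / complex_of_real (\<sigma> * sqrt (2 * pi))"
      unfolding inner by (rule integral_divide_zero)
    finally have "ennreal (\<sigma> * sqrt (2 * pi)) * (\<integral>\<^sup>+ x. ennreal (norm (inv_fourier h (\<sigma> * x)) ^ 2) \<partial>std_normal_distribution)
       = ennreal (\<sigma> * sqrt (2 * pi)) * ennreal (Re ((\<integral>\<xi>. h \<xi> * I n \<xi> \<partial>lborel) / complex_of_real (\<sigma> * sqrt (2 * pi))))"
      unfolding id by simp
    also have "\<dots> = ennreal (Re (\<integral>\<xi>. h \<xi> * I n \<xi> \<partial>lborel))"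
      unfolding Re_divide_of_real using \<sigma> by (simp flip: ennreal_mult')
    finally show "ennreal (Re (\<integral>\<xi>. h \<xi> * I n \<xi> \<partial>lborel)) \<le> ?R"
      using nn_integral_std_normal_scale_le[OF _ \<sigma>, of "\<lambda>x. ennreal (norm (inv_fourier h x) ^ 2)"] by simp
  qed
  finally show ?thesis .
qed

text \<open>The cross term of (x + y)^2 is split by expanding (\<eta> x - y)^2 / \<eta> \<ge> 0. The
  factor on \<open>b\<close> can be brought as close to 1 as desired, at the cost of a large factor
  on a difference that will tend to zero. This form integrates in \<open>ennreal\<close> without any
  finiteness assumption.\<close>

lemma norm_square_perturb:
  fixes a b :: "'a::real_normed_vector" and \<eta> :: real
  assumes "\<eta> > 0"
  shows "norm a ^ 2 \<le> (1 + \<eta>) * norm b ^ 2 + (1 + 1 / \<eta>) * norm (a - b) ^ 2"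
proof -
  define x y where "x = norm b" and "y = norm (a - b)"
  have "norm a \<le> x + y" using norm_triangle_sub[of a b] by (simp add: x_def y_def)
  then have "norm a ^ 2 \<le> (x + y) ^ 2" by (intro power_mono) auto
  also have "\<dots> \<le> (1 + \<eta>) * x ^ 2 + (1 + 1 / \<eta>) * y ^ 2"
  proof -
    have "0 \<le> (\<eta> * x - y) ^ 2 / \<eta>" using assms by simp
    then show ?thesis using assms by (simp add: power2_eq_square field_simps)
  qed
  finally show ?thesis by (simp add: x_def y_def)
qed

lemma nn_integral_norm_square_perturb:
  fixes f g :: "'a \<Rightarrow> complex" and \<eta> :: real
  assumes [measurable]: "f \<in> borel_measurable M" "g \<in> borel_measurable M" and \<eta>: "\<eta> > 0"
  shows "(\<integral>\<^sup>+ x. ennreal (norm (f x) ^ 2) \<partial>M) \<le>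
     ennreal (1 + \<eta>) * (\<integral>\<^sup>+ x. ennreal (norm (g x) ^ 2) \<partial>M)
     + ennreal (1 + 1 / \<eta>) * (\<integral>\<^sup>+ x. ennreal (norm (f x - g x) ^ 2) \<partial>M)"
proof -
  have "(\<integral>\<^sup>+ x. ennreal (norm (f x) ^ 2) \<partial>M) \<le> (\<integral>\<^sup>+ x. ennreal (1 + \<eta>) * ennreal (norm (g x) ^ 2)
      + ennreal (1 + 1 / \<eta>) * ennreal (norm (f x - g x) ^ 2) \<partial>M)"
    using \<eta> by (intro nn_integral_mono)
      (subst ennreal_mult[symmetric] ennreal_plus[symmetric], simp, simp,
       auto intro!: ennreal_leI norm_square_perturb simp flip: ennreal_mult ennreal_plus)
  also have "\<dots> = ennreal (1 + \<eta>) * (\<integral>\<^sup>+ x. ennreal (norm (g x) ^ 2) \<partial>M)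
     + ennreal (1 + 1 / \<eta>) * (\<integral>\<^sup>+ x. ennreal (norm (f x - g x) ^ 2) \<partial>M)"
    by (simp add: nn_integral_add nn_integral_cmult)
  finally show ?thesis .
qed

lemma integrable_cis_mult:
  fixes f :: "real \<Rightarrow> complex"
  assumes f: "integrable lborel f"
  shows "integrable lborel (\<lambda>\<xi>. cis (a * \<xi>) * f \<xi>)"
proof (rule Bochner_Integration.integrable_bound[OF f])
  have [measurable]: "f \<in> borel_measurable borel" using f by auto
  show "(\<lambda>\<xi>. cis (a * \<xi>) * f \<xi>) \<in> borel_measurable lborel" by measurable
qed (simp add: norm_mult)

lemma inv_fourier_diff:
  assumes "integrable lborel f" "integrable lborel g"
  shows "inv_fourier (\<lambda>\<xi>. f \<xi> - g \<xi>) x = inv_fourier f x - inv_fourier g x"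
proof -
  have eq: "2 * pi * (\<xi> * x) = (2 * pi * x) * \<xi>" for \<xi> by simp
  show ?thesis
    unfolding inv_fourier_def eq right_diff_distrib
    by (rule Bochner_Integration.integral_diff) (intro integrable_cis_mult assms)+
qed

text \<open>The lower bound survives L2 approximation: perturb from f to \<open>h n\<close> in
  frequency, apply the bound for \<open>h n\<close>, and perturb back in physical space, where
  Bessel's inequality returns the error to frequency. The limit in n is taken with \<eta> fixed, and
  only then does \<eta> tend to 0, since 1 + 1/\<eta> blows up.\<close>

lemma plancherel_ge_closed:
  fixes f :: "real \<Rightarrow> complex" and h :: "nat \<Rightarrow> real \<Rightarrow> complex"
  assumes f: "integrable lborel f" and h: "\<And>n. integrable lborel (h n)"
    and lim: "(\<lambda>n. \<integral>\<^sup>+ \<xi>. ennreal (norm (f \<xi> - h n \<xi>) ^ 2) \<partial>lborel) \<longlonglongrightarrow> 0"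
    and ge: "\<And>n. (\<integral>\<^sup>+ \<xi>. ennreal (norm (h n \<xi>) ^ 2) \<partial>lborel) \<le> (\<integral>\<^sup>+ x. ennreal (norm (inv_fourier (h n) x) ^ 2) \<partial>lborel)"
  shows "(\<integral>\<^sup>+ \<xi>. ennreal (norm (f \<xi>) ^ 2) \<partial>lborel) \<le> (\<integral>\<^sup>+ x. ennreal (norm (inv_fourier f x) ^ 2) \<partial>lborel)"
proof -
  have [measurable]: "f \<in> borel_measurable borel" using f by auto
  have [measurable]: "h n \<in> borel_measurable borel" for n using h[of n] by auto
  define D where "D = (\<lambda>n. \<integral>\<^sup>+ \<xi>. ennreal (norm (f \<xi> - h n \<xi>) ^ 2) \<partial>lborel)"
  define L where "L = (\<integral>\<^sup>+ \<xi>. ennreal (norm (f \<xi>) ^ 2) \<partial>lborel)"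
  define P where "P = (\<integral>\<^sup>+ x. ennreal (norm (inv_fourier f x) ^ 2) \<partial>lborel)"
  have le: "L \<le> ennreal (1 + \<eta>) * (ennreal (1 + \<eta>) * P)" if \<eta>: "\<eta> > 0" for \<eta> :: real
  proof -
    define a b where "a = ennreal (1 + \<eta>)" and "b = ennreal (1 + 1 / \<eta>)"
    have step: "L \<le> a * (a * P + b * D n) + b * D n" for n
    proof -
      have "L \<le> a * (\<integral>\<^sup>+ \<xi>. ennreal (norm (h n \<xi>) ^ 2) \<partial>lborel) + b * D n"
        unfolding L_def D_def a_def b_def by (rule nn_integral_norm_square_perturb[OF _ _ \<eta>]) auto
      moreover have "(\<integral>\<^sup>+ \<xi>. ennreal (norm (h n \<xi>) ^ 2) \<partial>lborel) \<le> a * P + b * D n"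
      proof -
        have "(\<integral>\<^sup>+ x. ennreal (norm (inv_fourier (h n) x) ^ 2) \<partial>lborel)
           \<le> a * P + b * (\<integral>\<^sup>+ x. ennreal (norm (inv_fourier (h n) x - inv_fourier f x) ^ 2) \<partial>lborel)"
          unfolding P_def a_def b_def by (rule nn_integral_norm_square_perturb[OF _ _ \<eta>]) auto
        also have "(\<integral>\<^sup>+ x. ennreal (norm (inv_fourier (h n) x - inv_fourier f x) ^ 2) \<partial>lborel) \<le> D n"
          using inv_fourier_bessel[of "\<lambda>\<xi>. f \<xi> - h n \<xi>"] f h[of n]
          by (simp add: D_def inv_fourier_diff norm_minus_commute)
        finally show ?thesis using ge[of n] by (meson add_left_mono mult_left_mono order_trans zero_le)
      qed
      ultimately show ?thesis
        by (meson add_mono mult_left_mono order_trans order_refl zero_le)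
    qed
    have "(\<lambda>n. a * (a * P + b * D n) + b * D n) \<longlonglongrightarrow> a * (a * P + b * 0) + b * 0"
      using lim unfolding D_def[symmetric]
      by (intro tendsto_add ennreal_tendsto_cmult tendsto_const) (auto simp: a_def b_def)
    then have "L \<le> a * (a * P + b * 0) + b * 0"
      by (rule LIMSEQ_le_const) (use step in auto)
    then show ?thesis by (simp add: a_def)
  qed
  have l1: "(\<lambda>n. ennreal (1 + inverse (real (Suc n)))) \<longlonglongrightarrow> 1"
    using tendsto_ennrealI[OF tendsto_add[OF tendsto_const LIMSEQ_inverse_real_of_nat], of 1] by simp
  have l2: "(\<lambda>n. ennreal (1 + inverse (real (Suc n))) * P) \<longlonglongrightarrow> 1 * P"
    by (rule tendsto_mult_ennreal[OF l1 tendsto_const]) auto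
  have "(\<lambda>n. ennreal (1 + inverse (real (Suc n))) * (ennreal (1 + inverse (real (Suc n))) * P)) \<longlonglongrightarrow> 1 * (1 * P)"
    by (rule tendsto_mult_ennreal[OF l1 l2]) auto
  then have "L \<le> 1 * (1 * P)"
    by (rule LIMSEQ_le_const) (intro exI[of _ 0] allI impI le, simp)
  then show ?thesis by (simp add: L_def P_def)
qed

text \<open>A measurable function is an almost everywhere limit of continuous ones. Truncating these
  in value and in support brings them under \<open>plancherel_ge_nice\<close> and provides a common
  majorant for dominated convergence.\<close>

lemma plancherel_ge_bounded:
  fixes f :: "real \<Rightarrow> complex"
  assumes f[measurable]: "f \<in> borel_measurable borel"
    and B: "\<And>x. norm (f x) \<le> B" and R: "\<And>x. \<bar>x\<bar> > R \<Longrightarrow> f x = 0" and B0: "B > 0"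
  shows "(\<integral>\<^sup>+ \<xi>. ennreal (norm (f \<xi>) ^ 2) \<partial>lborel) \<le> (\<integral>\<^sup>+ x. ennreal (norm (inv_fourier f x) ^ 2) \<partial>lborel)"
proof -
  have "f \<in> borel_measurable lebesgue"
    using f by (intro measurable_completion) simp
  then have "f measurable_on UNIV"
    using measurable_on_iff_borel_measurable[of UNIV f] by simp
  then obtain N g where N: "negligible N" and g: "\<And>n. continuous_on UNIV (g n)"
    and lim: "\<And>x. x \<notin> N \<Longrightarrow> (\<lambda>n. g n x) \<longlonglongrightarrow> f x"
    unfolding measurable_on_def by auto
  have [measurable]: "g n \<in> borel_measurable borel" for n
    using g by (rule borel_measurable_continuous_onI)
  have AE: "AE x in lborel. x \<notin> N"
    using N AE_not_in[of N lebesgue] by (simp add: negligible_iff_null_sets AE_completion_iff)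
  \<comment> \<open>The radial retraction onto the closed ball of radius B: it is continuous, fixes
    every value of f, and so bounds the approximants uniformly without changing their limit.\<close>
  define T where "T = (\<lambda>z::complex. complex_of_real (B / max B (norm z)) * z)"
  have Tc: "continuous_on UNIV T"
    unfolding T_def using B0 by (intro continuous_intros) (auto simp: max_def)
  have TB: "norm (T z) \<le> B" for z
  proof -
    have "norm (T z) = B / max B (norm z) * norm z"
      unfolding T_def norm_mult norm_of_real using B0 by simp
    also have "\<dots> \<le> B" using B0 by (simp add: field_simps max_def)
    finally show ?thesis .
  qed
  have Tid: "T z = z" if "norm z \<le> B" for z
    using B0 that by (simp add: T_def max_def)
  have [measurable]: "T \<in> borel_measurable borel"
    using Tc by (rule borel_measurable_continuous_onI)
  define h where "h = (\<lambda>n x. if \<bar>x\<bar> \<le> R then T (g n x) else 0)"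
  have hm[measurable]: "h n \<in> borel_measurable borel" for n unfolding h_def by measurable
  have hB: "norm (h n x) \<le> B" for n x using TB B0 by (simp add: h_def)
  have hR: "h n x = 0" if "\<bar>x\<bar> > R" for n x using that by (simp add: h_def)
  have hc: "isCont (h n) x" if "\<bar>x\<bar> \<noteq> R" for n x
  proof (cases "\<bar>x\<bar> < R")
    case True
    have "continuous_on {-R<..<R} (\<lambda>x. T (g n x))"
      by (intro continuous_on_compose2[OF Tc] continuous_on_subset[OF g]) auto
    then have "continuous_on {-R<..<R} (h n)"
      by (rule continuous_on_eq) (auto simp: h_def)
    then show ?thesis using True by (auto simp: continuous_on_eq_continuous_at abs_less_iff)
  next
    case False
    then have x: "x \<in> - {-R..R}" using that by auto
    have "continuous_on (- {-R..R}) (\<lambda>x. 0::complex)" by (rule continuous_on_const)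
    then have "continuous_on (- {-R..R}) (h n)"
      by (rule continuous_on_eq) (auto simp: h_def abs_le_iff)
    then show ?thesis using x by (auto simp: continuous_on_eq_continuous_at open_Compl)
  qed
  have conv: "(\<lambda>n. h n x) \<longlonglongrightarrow> f x" if "x \<notin> N" for x
  proof (cases "\<bar>x\<bar> \<le> R")
    case True
    have "isCont T (f x)" using Tc by (simp add: continuous_on_eq_continuous_at)
    then have "(\<lambda>n. T (g n x)) \<longlonglongrightarrow> T (f x)"
      by (rule isCont_tendsto_compose) (rule lim[OF that])
    then show ?thesis using True Tid[OF B] by (simp add: h_def)
  next
    case False
    then show ?thesis using R[of x] by (simp add: h_def)
  qed
  show ?thesis
  proof (rule plancherel_ge_closed[where h = h])
    show "integrable lborel f" by (rule integrable_bounded_support[OF f B R])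
    show "integrable lborel (h n)" for n by (rule integrable_bounded_support[OF hm hB hR])
    show "(\<integral>\<^sup>+ \<xi>. ennreal (norm (h n \<xi>) ^ 2) \<partial>lborel) \<le> (\<integral>\<^sup>+ x. ennreal (norm (inv_fourier (h n) x) ^ 2) \<partial>lborel)" for n
      by (rule plancherel_ge_nice[OF hm hB hR hc])
    have "(\<lambda>n. \<integral>\<^sup>+ \<xi>. ennreal (norm (f \<xi> - h n \<xi>) ^ 2) \<partial>lborel) \<longlonglongrightarrow> (\<integral>\<^sup>+ \<xi>. 0 \<partial>(lborel :: real measure))"
    proof (rule nn_integral_dominated_convergence[where w = "\<lambda>x. ennreal ((2 * B) ^ 2) * indicator {-R..R} x"])
      show "AE x in lborel. ennreal (norm (f x - h n x) ^ 2) \<le> ennreal ((2 * B) ^ 2) * indicator {-R..R} x" for n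
      proof (rule AE_I2)
        fix x
        have "norm (f x - h n x) \<le> 2 * B"
          using norm_triangle_ineq4[of "f x" "h n x"] B[of x] hB[of n x] by linarith
        then have "norm (f x - h n x) ^ 2 \<le> (2 * B) ^ 2" by (intro power_mono) auto
        then show "ennreal (norm (f x - h n x) ^ 2) \<le> ennreal ((2 * B) ^ 2) * indicator {-R..R} x"
          using R[of x] hR[of x n] by (cases "\<bar>x\<bar> > R") (auto simp: indicator_def abs_le_iff intro!: ennreal_leI)
      qed
      show "AE x in lborel. (\<lambda>n. ennreal (norm (f x - h n x) ^ 2)) \<longlonglongrightarrow> 0"
        using AE
      proof eventually_elim
        case (elim x)
        have "(\<lambda>n. norm (f x - h n x) ^ 2) \<longlonglongrightarrow> norm (f x - f x) ^ 2"
          by (intro tendsto_intros conv elim)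
        from tendsto_ennrealI[OF this] show ?case by simp
      qed
      show "(\<integral>\<^sup>+ x. ennreal ((2 * B) ^ 2) * indicator {-R..R} x \<partial>lborel) < \<infinity>"
        by (simp add: nn_integral_cmult ennreal_mult_less_top emeasure_lborel_Icc_eq)
    qed auto
    then show "(\<lambda>n. \<integral>\<^sup>+ \<xi>. ennreal (norm (f \<xi> - h n \<xi>) ^ 2) \<partial>lborel) \<longlonglongrightarrow> 0" by simp
  qed
qed

text \<open>Cutting f to where both its argument and its value are at most \<open>Suc n\<close>
  changes nothing at a given point for large n, and the error is dominated by |f|^2. This is the
  direction that the theorem calls for, since the data are measured in physical space while the
  estimate is proved in frequency.\<close>

lemma plancherel_ge:
  fixes f :: "real \<Rightarrow> complex"
  assumes f: "integrable lborel f" and f2: "(\<integral>\<^sup>+ \<xi>. ennreal (norm (f \<xi>) ^ 2) \<partial>lborel) < \<infinity>"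
  shows "(\<integral>\<^sup>+ \<xi>. ennreal (norm (f \<xi>) ^ 2) \<partial>lborel) \<le> (\<integral>\<^sup>+ x. ennreal (norm (inv_fourier f x) ^ 2) \<partial>lborel)"
proof -
  have [measurable]: "f \<in> borel_measurable borel" using f by auto
  define h where "h = (\<lambda>n x. if \<bar>x\<bar> \<le> real (Suc n) \<and> norm (f x) \<le> real (Suc n) then f x else 0)"
  have hm[measurable]: "h n \<in> borel_measurable borel" for n unfolding h_def by measurable
  have hB: "norm (h n x) \<le> real (Suc n)" for n x by (simp add: h_def)
  have hR: "h n x = 0" if "\<bar>x\<bar> > real (Suc n)" for n x using that by (simp add: h_def)
  show ?thesis
  proof (rule plancherel_ge_closed[OF f, where h = h])
    show "integrable lborel (h n)" for n by (rule integrable_bounded_support[OF hm hB hR])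
    show "(\<integral>\<^sup>+ \<xi>. ennreal (norm (h n \<xi>) ^ 2) \<partial>lborel) \<le> (\<integral>\<^sup>+ x. ennreal (norm (inv_fourier (h n) x) ^ 2) \<partial>lborel)" for n
      by (rule plancherel_ge_bounded[OF hm hB hR]) auto
    have "(\<lambda>n. \<integral>\<^sup>+ \<xi>. ennreal (norm (f \<xi> - h n \<xi>) ^ 2) \<partial>lborel) \<longlonglongrightarrow> (\<integral>\<^sup>+ \<xi>. 0 \<partial>(lborel :: real measure))"
    proof (rule nn_integral_dominated_convergence[where w = "\<lambda>x. ennreal (norm (f x) ^ 2)"])
      show "AE x in lborel. ennreal (norm (f x - h n x) ^ 2) \<le> ennreal (norm (f x) ^ 2)" for n
        by (rule AE_I2) (simp add: h_def)
      show "AE x in lborel. (\<lambda>n. ennreal (norm (f x - h n x) ^ 2)) \<longlonglongrightarrow> 0"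
      proof (rule AE_I2)
        fix x
        obtain n0 where n0: "max \<bar>x\<bar> (norm (f x)) \<le> real n0" using real_arch_simple by blast
        have "\<forall>\<^sub>F n in sequentially. ennreal (norm (f x - h n x) ^ 2) = 0"
          using eventually_ge_at_top[of n0] by eventually_elim (use n0 in \<open>auto simp: h_def\<close>)
        then show "(\<lambda>n. ennreal (norm (f x - h n x) ^ 2)) \<longlonglongrightarrow> 0"
          by (rule tendsto_eventually)
      qed
    qed (use f2 in auto)
    then show "(\<lambda>n. \<integral>\<^sup>+ \<xi>. ennreal (norm (f \<xi> - h n \<xi>) ^ 2) \<partial>lborel) \<longlonglongrightarrow> 0" by simp
  qed
qed

subsection \<open>Counting near hyperbolas\<close>

text \<open>With s = sqrt m one has (a^2 - m)^2 = (a - s)^2 (a + s)^2, and the factor of the root on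
  the opposite side of 0 is at least m. What remains is a Gaussian of width 1/sqrt m at the nearer
  root.\<close>

lemma exp_quartic_le:
  fixes a m :: real
  assumes "m \<ge> 0"
  shows "exp (- ((a\<^sup>2 - m)\<^sup>2)) \<le> exp (- (m * (a - sqrt m)\<^sup>2)) + exp (- (m * (a + sqrt m)\<^sup>2))"
proof -
  define s where "s = sqrt m"
  have s: "s \<ge> 0" "m = s\<^sup>2" using assms by (auto simp: s_def)
  have eq: "(a\<^sup>2 - m)\<^sup>2 = (a + s)\<^sup>2 * (a - s)\<^sup>2" unfolding s(2) by (simp add: power2_eq_square algebra_simps)
  show ?thesis
  proof (cases "a \<ge> 0")
    case True
    have "m * (a - s)\<^sup>2 \<le> (a\<^sup>2 - m)\<^sup>2"
      unfolding eq unfolding s(2) using True s(1) by (intro mult_right_mono power_mono) auto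
    then have "exp (- ((a\<^sup>2 - m)\<^sup>2)) \<le> exp (- (m * (a - s)\<^sup>2))" by simp
    then show ?thesis unfolding s_def by (smt (verit) exp_gt_zero)
  next
    case False
    have "s\<^sup>2 \<le> (s - a)\<^sup>2" using False s(1) by (intro power_mono) auto
    then have "m * (a + s)\<^sup>2 \<le> (a\<^sup>2 - m)\<^sup>2"
      unfolding eq unfolding s(2) by (subst mult.commute, intro mult_left_mono) (auto simp: power2_commute)
    then have "exp (- ((a\<^sup>2 - m)\<^sup>2)) \<le> exp (- (m * (a + s)\<^sup>2))" by simp
    then show ?thesis unfolding s_def by (smt (verit) exp_gt_zero)
  qed
qed

lemma nn_integral_gauss':
  assumes "m > 0"
  shows "(\<integral>\<^sup>+ a. ennreal (exp (- (m * (a - b)\<^sup>2))) \<partial>lborel) = ennreal (sqrt pi / sqrt m)"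
proof -
  have "exp (- (m * (a - b)\<^sup>2)) = exp (- ((sqrt (2 * m) * (b - a))\<^sup>2) / 2)" for a
    using assms by (simp add: power_mult_distrib power2_commute)
  then have "(\<integral>\<^sup>+ a. ennreal (exp (- (m * (a - b)\<^sup>2))) \<partial>lborel) = ennreal (sqrt (2 * pi) / sqrt (2 * m))"
    using nn_integral_gauss[of "sqrt (2 * m)" b] assms by (simp only: real_sqrt_gt_zero)
  then show ?thesis by (simp add: real_sqrt_mult)
qed

text \<open>A smooth form of the length of the set where |a^2 - m| is at most 1. For m \<ge> 1 there
  are two Gaussians at the roots, whence the factor 2; for m \<le> -1 the cross term 2|m| a^2 of the
  square suffices; for |m| < 1 a fixed Gaussian with the factor exp(9/4) does.\<close>

lemma nn_integral_exp_quartic: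
  fixes m :: real
  shows "(\<integral>\<^sup>+ a. ennreal (exp (- ((a\<^sup>2 - m)\<^sup>2))) \<partial>lborel)
           \<le> ennreal (2 * exp (9 / 4) * sqrt (2 * pi) / sqrt (1 + \<bar>m\<bar>))"
proof -
  have e1: "1 \<le> exp (9 / 4 :: real)" by simp
  have large: "1 / sqrt \<bar>m\<bar> \<le> sqrt 2 / sqrt (1 + \<bar>m\<bar>)" if "\<bar>m\<bar> \<ge> 1"
  proof -
    have "sqrt (1 + \<bar>m\<bar>) \<le> sqrt (2 * \<bar>m\<bar>)" using that by simp
    moreover have "sqrt \<bar>m\<bar> > 0" using that by (smt (verit) real_sqrt_gt_zero)
    ultimately show ?thesis by (simp add: field_simps real_sqrt_mult)
  qed
  have large': "c * (sqrt pi / sqrt \<bar>m\<bar>) \<le> 2 * exp (9 / 4) * sqrt (2 * pi) / sqrt (1 + \<bar>m\<bar>)"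
    if "\<bar>m\<bar> \<ge> 1" "0 \<le> c" "c \<le> 2" for c
  proof -
    have c: "c \<le> 2 * exp (9 / 4)" using that(3) e1 by linarith
    have "c * (sqrt pi / sqrt \<bar>m\<bar>) = c * sqrt pi * (1 / sqrt \<bar>m\<bar>)" by simp
    also have "\<dots> \<le> (2 * exp (9 / 4)) * sqrt pi * (sqrt 2 / sqrt (1 + \<bar>m\<bar>))"
      by (intro mult_mono large that c) (use that in auto)
    finally show ?thesis by (simp add: real_sqrt_mult mult_ac)
  qed
  consider "m \<ge> 1" | "m \<le> -1" | "\<bar>m\<bar> < 1" by linarith
  then show ?thesis
  proof cases
    case 1
    have "(\<integral>\<^sup>+ a. ennreal (exp (- ((a\<^sup>2 - m)\<^sup>2))) \<partial>lborel) \<le>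
      (\<integral>\<^sup>+ a. ennreal (exp (- (m * (a - sqrt m)\<^sup>2))) + ennreal (exp (- (m * (a - (- sqrt m))\<^sup>2))) \<partial>lborel)"
      using 1 by (intro nn_integral_mono)
        (simp add: exp_quartic_le ennreal_leI flip: ennreal_plus)
    also have "\<dots> = ennreal (sqrt pi / sqrt m) + ennreal (sqrt pi / sqrt m)"
      using 1 by (subst nn_integral_add) (simp_all only: nn_integral_gauss', auto)
    also have "\<dots> = ennreal (2 * (sqrt pi / sqrt \<bar>m\<bar>))"
      using 1 by (simp flip: ennreal_plus)
    also have "\<dots> \<le> ennreal (2 * exp (9 / 4) * sqrt (2 * pi) / sqrt (1 + \<bar>m\<bar>))"
      using 1 by (intro ennreal_leI large') auto
    finally show ?thesis .
  next
    case 2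
    have "(\<integral>\<^sup>+ a. ennreal (exp (- ((a\<^sup>2 - m)\<^sup>2))) \<partial>lborel) \<le>
      (\<integral>\<^sup>+ a. ennreal (exp (- (\<bar>m\<bar> * (a - 0)\<^sup>2))) \<partial>lborel)"
    proof (intro nn_integral_mono ennreal_leI)
      fix a
      have "\<bar>m\<bar> * a\<^sup>2 \<le> (a\<^sup>2 - m)\<^sup>2"
      proof -
        have "0 \<le> \<bar>m\<bar> * a\<^sup>2 + (a\<^sup>2)\<^sup>2 + m\<^sup>2" by simp
        also have "\<bar>m\<bar> * a\<^sup>2 + (a\<^sup>2)\<^sup>2 + m\<^sup>2 = (a\<^sup>2 - m)\<^sup>2 - \<bar>m\<bar> * a\<^sup>2"
          using 2 by (simp add: power2_eq_square algebra_simps)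
        finally show ?thesis by simp
      qed
      then show "exp (- ((a\<^sup>2 - m)\<^sup>2)) \<le> exp (- (\<bar>m\<bar> * (a - 0)\<^sup>2))" by simp
    qed
    also have "\<dots> = ennreal (1 * (sqrt pi / sqrt \<bar>m\<bar>))"
      using 2 by (subst nn_integral_gauss') auto
    also have "\<dots> \<le> ennreal (2 * exp (9 / 4) * sqrt (2 * pi) / sqrt (1 + \<bar>m\<bar>))"
      using 2 by (intro ennreal_leI large') auto
    finally show ?thesis .
  next
    case 3
    have "(\<integral>\<^sup>+ a. ennreal (exp (- ((a\<^sup>2 - m)\<^sup>2))) \<partial>lborel) \<le>
      (\<integral>\<^sup>+ a. ennreal (exp (9 / 4)) * ennreal (exp (- (1 * (a - 0)\<^sup>2))) \<partial>lborel)"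
    proof (intro nn_integral_mono)
      fix a :: real
      have "a\<^sup>2 - 9 / 4 \<le> (a\<^sup>2 - m)\<^sup>2"
      proof -
        \<comment> \<open>Completing the square in (a^2 - m)^2 - a^2 with 3/2 leaves the constant
          9/4; the last summand is nonnegative because m < 1.\<close>
        have "0 \<le> (a\<^sup>2 - 3 / 2)\<^sup>2 + m\<^sup>2 + 2 * (1 - m) * a\<^sup>2" using 3 by simp
        also have "\<dots> = (a\<^sup>2 - m)\<^sup>2 - (a\<^sup>2 - 9 / 4)"
          by (simp add: power2_eq_square algebra_simps)
        finally show ?thesis by simp
      qed
      then have "exp (- ((a\<^sup>2 - m)\<^sup>2)) \<le> exp (9 / 4 - a\<^sup>2)" by simp
      also have "\<dots> = exp (9 / 4) * exp (- (1 * (a - 0)\<^sup>2))" by (simp flip: exp_add)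
      finally show "ennreal (exp (- ((a\<^sup>2 - m)\<^sup>2))) \<le> ennreal (exp (9 / 4)) * ennreal (exp (- (1 * (a - 0)\<^sup>2)))"
        by (simp add: ennreal_leI flip: ennreal_mult)
    qed
    also have "\<dots> = ennreal (exp (9 / 4)) * ennreal (sqrt pi / sqrt 1)"
      by (subst nn_integral_cmult) (simp_all only: nn_integral_gauss', auto)
    also have "\<dots> = ennreal (exp (9 / 4) * sqrt pi)" by (simp flip: ennreal_mult)
    also have "\<dots> \<le> ennreal (2 * exp (9 / 4) * sqrt (2 * pi) / sqrt (1 + \<bar>m\<bar>))"
    proof (intro ennreal_leI)
      have "sqrt (1 + \<bar>m\<bar>) \<le> sqrt 2" using 3 by simp
      then have "sqrt (1 + \<bar>m\<bar>) \<le> 2 * sqrt 2" by (rule order_trans) simp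
      then have "1 \<le> 2 * (sqrt 2 / sqrt (1 + \<bar>m\<bar>))" by (simp add: field_simps)
      then have "exp (9 / 4) * sqrt pi * 1 \<le> exp (9 / 4) * sqrt pi * (2 * (sqrt 2 / sqrt (1 + \<bar>m\<bar>)))"
        by (intro mult_left_mono) auto
      then show "exp (9 / 4) * sqrt pi \<le> 2 * exp (9 / 4) * sqrt (2 * pi) / sqrt (1 + \<bar>m\<bar>)"
        by (simp add: real_sqrt_mult mult_ac)
    qed
    finally show ?thesis .
  qed
qed

section \<open>Sums over the integer frequencies in the support of the cutoff\<close>

definition freq_box :: "real \<Rightarrow> int set" where
  "freq_box N = {k. \<bar>real_of_int k\<bar> \<le> 2 * N}"

lemma freq_box_eq: "freq_box N = {- \<lfloor>2 * N\<rfloor> .. \<lfloor>2 * N\<rfloor>}"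
proof -
  have "k \<in> freq_box N \<longleftrightarrow> \<bar>k\<bar> \<le> \<lfloor>2 * N\<rfloor>" for k
    by (simp add: freq_box_def le_floor_iff)
  then show ?thesis by (intro set_eqI) (simp only: atLeastAtMost_iff abs_le_iff, linarith)
qed

lemma finite_freq_box [simp]: "finite (freq_box N)"
  by (simp add: freq_box_eq)

text \<open>At most 4N + 1 integers, and 1 \<le> N.\<close>

lemma card_freq_box: "N \<ge> 1 \<Longrightarrow> real (card (freq_box N)) \<le> 5 * N"
  using of_int_floor_le[of "2 * N"] by (simp add: freq_box_eq) linarith

text \<open>On each side of n the distance to n determines k, so every value of the distance occurs
  at most twice.\<close>

lemma sum_int_le_suminf:
  fixes w :: "nat \<Rightarrow> real" and A :: "int set"
  assumes w: "summable w" "\<And>j. w j \<ge> 0" and A: "finite A"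
  shows "(\<Sum>k\<in>A. w (nat \<bar>k - n\<bar>)) \<le> 2 * suminf w"
proof -
  have half: "(\<Sum>k\<in>B. w (nat \<bar>k - n\<bar>)) \<le> suminf w"
    if "finite B" "inj_on (\<lambda>k. nat \<bar>k - n\<bar>) B" for B
    using sum_le_suminf[OF w(1), of "(\<lambda>k. nat \<bar>k - n\<bar>) ` B"] that w(2)
    by (simp add: sum.reindex)
  have "(\<Sum>k\<in>A. w (nat \<bar>k - n\<bar>)) = (\<Sum>k\<in>{k\<in>A. k \<ge> n}. w (nat \<bar>k - n\<bar>)) + (\<Sum>k\<in>{k\<in>A. \<not> k \<ge> n}. w (nat \<bar>k - n\<bar>))"
    using A by (subst sum.union_disjoint[symmetric]) (auto intro!: sum.cong)
  also have "\<dots> \<le> suminf w + suminf w"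
    by (intro add_mono half) (use A in \<open>auto simp: inj_on_def\<close>)
  finally show ?thesis by simp
qed

text \<open>A harmonic sum, bounded uniformly in its centre. Terms v \<le> 1/N contribute at most 5
  in total. For the others v = (1/v)^\<epsilon> v^(1+\<epsilon>) \<le> N^\<epsilon>
  v^(1+\<epsilon>), and the powers v^(1+\<epsilon>) are summable.\<close>

lemma sum_inverse_sqrt_bound:
  fixes \<epsilon> :: real
  assumes \<epsilon>: "\<epsilon> > 0"
  shows "\<exists>C>0. \<forall>N\<ge>1. \<forall>x::real. (\<Sum>k\<in>freq_box N. 1 / sqrt (1 + (real_of_int k - x)\<^sup>2)) \<le> C * N powr \<epsilon>"
proof -
  define w where "w = (\<lambda>j::nat. real (Suc j) powr (- (1 + \<epsilon>)))"
  have w: "summable w" "w j \<ge> 0" for j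
    unfolding w_def using \<epsilon> summable_Suc_iff[of "\<lambda>j. real j powr (- (1 + \<epsilon>))"] by (auto simp: summable_real_powr_iff)
  define C where "C = 5 + 4 powr (1 + \<epsilon>) * (2 * suminf w)"
  have s0: "suminf w \<ge> 0" using w by (simp add: suminf_nonneg)
  have C: "C > 0" unfolding C_def using s0 by (intro add_pos_nonneg mult_nonneg_nonneg) auto
  moreover have "(\<Sum>k\<in>freq_box N. 1 / sqrt (1 + (real_of_int k - x)\<^sup>2)) \<le> C * N powr \<epsilon>" if N: "N \<ge> 1" for N x :: real
  proof -
    \<comment> \<open>Rounding the centre to an integer makes the distances natural numbers, so that
      one convergent series \<open>w\<close> serves all x; the factor 4 below absorbs the
      rounding.\<close>
    define n where "n = \<lfloor>x\<rfloor>"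
    have pt: "1 / sqrt (1 + (real_of_int k - x)\<^sup>2) \<le> 1 / N + N powr \<epsilon> * (4 powr (1 + \<epsilon>) * w (nat \<bar>k - n\<bar>))" for k
    proof -
      define v where "v = 1 / sqrt (1 + (real_of_int k - x)\<^sup>2)"
      have v0: "v > 0" unfolding v_def by (simp add: add_pos_nonneg)
      show ?thesis
      proof (cases "v \<le> 1 / N")
        case True
        have "0 \<le> N powr \<epsilon> * (4 powr (1 + \<epsilon>) * w (nat \<bar>k - n\<bar>))" using w by simp
        then show ?thesis using True by (simp add: v_def)
      next
        case False
        define d where "d = \<bar>real_of_int k - x\<bar>"
        have "real (Suc (nat \<bar>k - n\<bar>)) \<le> 2 + d"
          unfolding d_def n_def by (simp, linarith)
        also have "\<dots> \<le> 4 * sqrt (1 + d\<^sup>2)"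
        proof -
          have "1 \<le> sqrt (1 + d\<^sup>2)" "d \<le> sqrt (1 + d\<^sup>2)"
            by (auto intro: real_le_rsqrt)
          then show ?thesis by linarith
        qed
        finally have le: "real (Suc (nat \<bar>k - n\<bar>)) \<le> 4 * sqrt (1 + d\<^sup>2)" .
        have "v = 1 / sqrt (1 + d\<^sup>2)" by (simp add: v_def d_def)
        also have "\<dots> \<le> 4 / real (Suc (nat \<bar>k - n\<bar>))"
          using le by (simp add: divide_simps add_pos_nonneg)
        finally have v4: "v \<le> 4 / real (Suc (nat \<bar>k - n\<bar>))" .
        have "v powr (1 + \<epsilon>) \<le> (4 / real (Suc (nat \<bar>k - n\<bar>))) powr (1 + \<epsilon>)"
          using v4 v0 \<epsilon> by (intro powr_mono2) auto
        also have "\<dots> = 4 powr (1 + \<epsilon>) * w (nat \<bar>k - n\<bar>)"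
          unfolding w_def by (simp only: powr_divide powr_minus_divide times_divide_eq_right mult_1_right)
        finally have vp: "v powr (1 + \<epsilon>) \<le> 4 powr (1 + \<epsilon>) * w (nat \<bar>k - n\<bar>)" .
        have "1 / v \<le> N" using False N v0 by (simp add: field_simps)
        then have "(1 / v) powr \<epsilon> \<le> N powr \<epsilon>" using v0 \<epsilon> by (intro powr_mono2) auto
        moreover have "v = (1 / v) powr \<epsilon> * v powr (1 + \<epsilon>)"
          using v0 by (simp add: powr_add powr_divide)
        ultimately have "v \<le> N powr \<epsilon> * (4 powr (1 + \<epsilon>) * w (nat \<bar>k - n\<bar>))"
          using vp by (metis mult_mono powr_ge_zero)
        then show ?thesis using N unfolding v_def by (smt (verit) divide_nonneg_nonneg)
      qed
    qed
    have "(\<Sum>k\<in>freq_box N. 1 / sqrt (1 + (real_of_int k - x)\<^sup>2))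
        \<le> (\<Sum>k\<in>freq_box N. 1 / N + N powr \<epsilon> * (4 powr (1 + \<epsilon>) * w (nat \<bar>k - n\<bar>)))"
      by (intro sum_mono pt)
    also have "\<dots> = real (card (freq_box N)) / N + N powr \<epsilon> * (4 powr (1 + \<epsilon>) * (\<Sum>k\<in>freq_box N. w (nat \<bar>k - n\<bar>)))"
      by (simp add: sum.distrib sum_distrib_left)
    also have "\<dots> \<le> 5 + N powr \<epsilon> * (4 powr (1 + \<epsilon>) * (2 * suminf w))"
      using card_freq_box[OF N] N
      by (intro add_mono mult_left_mono sum_int_le_suminf w) (auto simp: field_simps)
    also have "\<dots> \<le> 5 * N powr \<epsilon> + N powr \<epsilon> * (4 powr (1 + \<epsilon>) * (2 * suminf w))"
      using ge_one_powr_ge_zero[OF N, of \<epsilon>] \<epsilon> by simp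
    finally show ?thesis by (simp add: C_def algebra_simps)
  qed
  ultimately show ?thesis by blast
qed

text \<open>Factor the left side as |b - M||b + M| and replace the larger factor by the smaller one;
  the sign of b tells which is which.\<close>

lemma abs_square_diff_ge:
  fixes b M :: real
  assumes "M \<ge> 0"
  shows "min ((b - M)\<^sup>2) ((b + M)\<^sup>2) \<le> \<bar>b\<^sup>2 - M\<^sup>2\<bar>"
proof -
  have eq: "\<bar>b\<^sup>2 - M\<^sup>2\<bar> = \<bar>b - M\<bar> * \<bar>b + M\<bar>"
    by (simp add: power2_eq_square algebra_simps flip: abs_mult)
  show ?thesis
  proof (cases "b \<ge> 0")
    case True
    then have "\<bar>b - M\<bar> * \<bar>b - M\<bar> \<le> \<bar>b - M\<bar> * \<bar>b + M\<bar>" using assms by (intro mult_left_mono) auto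
    then show ?thesis unfolding eq by (simp add: power2_eq_square min_le_iff_disj)
  next
    case False
    then have "\<bar>b + M\<bar> * \<bar>b + M\<bar> \<le> \<bar>b - M\<bar> * \<bar>b + M\<bar>" using assms by (intro mult_right_mono) auto
    then show ?thesis unfolding eq by (simp add: power2_eq_square min_le_iff_disj)
  qed
qed

text \<open>The slice bound leaves a sum of 1/sqrt(1 + |b^2 + \<tau>|), which splits into two
  harmonic sums centred where b^2 + \<tau> is smallest. Uniformity in c and \<tau> matters because
  both vary with the pair of frequencies that labels a row of the kernel.\<close>

lemma hyperbola_count:
  fixes \<epsilon> :: real
  assumes \<epsilon>: "\<epsilon> > 0"
  shows "\<exists>C>0. \<forall>N\<ge>1. \<forall>c \<tau>::real.
    (\<Sum>k\<in>freq_box N. \<integral>\<^sup>+ a. ennreal (exp (- ((a\<^sup>2 - ((real_of_int k - c)\<^sup>2 + \<tau>))\<^sup>2))) \<partial>lborel) \<le> ennreal (C * N powr \<epsilon>)"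
proof -
  obtain C where C: "C > 0" and bd: "\<And>N x::real. N \<ge> 1 \<Longrightarrow> (\<Sum>k\<in>freq_box N. 1 / sqrt (1 + (real_of_int k - x)\<^sup>2)) \<le> C * N powr \<epsilon>"
    using sum_inverse_sqrt_bound[OF \<epsilon>] by blast
  define D :: real where "D = 2 * exp (9 / 4) * sqrt (2 * pi)"
  have D: "D > 0" by (simp add: D_def)
  have "(\<Sum>k\<in>freq_box N. \<integral>\<^sup>+ a. ennreal (exp (- ((a\<^sup>2 - ((real_of_int k - c)\<^sup>2 + \<tau>))\<^sup>2))) \<partial>lborel) \<le> ennreal ((2 * D * C) * N powr \<epsilon>)"
    if N: "N \<ge> 1" for N c \<tau> :: real
  proof -
    \<comment> \<open>For \<tau> < 0 the zeros of b^2 + \<tau> are M and -M; for \<tau> \<ge> 0 the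
      minimum is at b = 0.\<close>
    define M where "M = (if \<tau> \<ge> 0 then 0 else sqrt (- \<tau>))"
    have pt: "1 / sqrt (1 + \<bar>(real_of_int k - c)\<^sup>2 + \<tau>\<bar>) \<le>
        1 / sqrt (1 + (real_of_int k - (c + M))\<^sup>2) + 1 / sqrt (1 + (real_of_int k - (c - M))\<^sup>2)" for k
    proof -
      define b where "b = real_of_int k - c"
      have m: "min ((b - M)\<^sup>2) ((b + M)\<^sup>2) \<le> \<bar>b\<^sup>2 + \<tau>\<bar>"
      proof (cases "\<tau> \<ge> 0")
        case True then show ?thesis by (simp add: M_def)
      next
        case False
        then have "\<tau> = - (M\<^sup>2)" "M \<ge> 0" by (auto simp: M_def)
        then show ?thesis using abs_square_diff_ge[of M b] by simp
      qed
      have mono: "1 / sqrt (1 + \<bar>b\<^sup>2 + \<tau>\<bar>) \<le> 1 / sqrt (1 + y)" if "0 \<le> y" "y \<le> \<bar>b\<^sup>2 + \<tau>\<bar>" for y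
        using that by (intro divide_left_mono mult_pos_pos) auto
      have nn: "0 \<le> 1 / sqrt (1 + (b - M)\<^sup>2)" "0 \<le> 1 / sqrt (1 + (b + M)\<^sup>2)" by auto
      have "1 / sqrt (1 + \<bar>b\<^sup>2 + \<tau>\<bar>) \<le> 1 / sqrt (1 + (b - M)\<^sup>2) + 1 / sqrt (1 + (b + M)\<^sup>2)"
        using m mono[of "(b - M)\<^sup>2"] mono[of "(b + M)\<^sup>2"] nn unfolding min_le_iff_disj
        by (meson add_increasing add_increasing2 zero_le_power2)
      then show ?thesis by (simp add: b_def algebra_simps)
    qed
    have "(\<Sum>k\<in>freq_box N. \<integral>\<^sup>+ a. ennreal (exp (- ((a\<^sup>2 - ((real_of_int k - c)\<^sup>2 + \<tau>))\<^sup>2))) \<partial>lborel)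
        \<le> (\<Sum>k\<in>freq_box N. ennreal (D / sqrt (1 + \<bar>(real_of_int k - c)\<^sup>2 + \<tau>\<bar>)))"
      unfolding D_def by (intro sum_mono nn_integral_exp_quartic)
    also have "\<dots> = ennreal (\<Sum>k\<in>freq_box N. D / sqrt (1 + \<bar>(real_of_int k - c)\<^sup>2 + \<tau>\<bar>))"
      using D by (intro sum_ennreal) auto
    also have "\<dots> \<le> ennreal (\<Sum>k\<in>freq_box N. D * (1 / sqrt (1 + (real_of_int k - (c + M))\<^sup>2) + 1 / sqrt (1 + (real_of_int k - (c - M))\<^sup>2)))"
    proof (intro ennreal_leI sum_mono)
      fix k
      show "D / sqrt (1 + \<bar>(real_of_int k - c)\<^sup>2 + \<tau>\<bar>) \<le> D * (1 / sqrt (1 + (real_of_int k - (c + M))\<^sup>2) + 1 / sqrt (1 + (real_of_int k - (c - M))\<^sup>2))"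
        using mult_left_mono[OF pt[of k], of D] D by simp
    qed
    also have "(\<Sum>k\<in>freq_box N. D * (1 / sqrt (1 + (real_of_int k - (c + M))\<^sup>2) + 1 / sqrt (1 + (real_of_int k - (c - M))\<^sup>2)))
       = D * ((\<Sum>k\<in>freq_box N. 1 / sqrt (1 + (real_of_int k - (c + M))\<^sup>2)) + (\<Sum>k\<in>freq_box N. 1 / sqrt (1 + (real_of_int k - (c - M))\<^sup>2)))"
      by (simp only: sum_distrib_left[symmetric] sum.distrib)
    also have "ennreal \<dots> \<le> ennreal (D * (C * N powr \<epsilon> + C * N powr \<epsilon>))"
      using D by (intro ennreal_leI mult_left_mono add_mono bd N) auto
    finally show ?thesis by (simp add: algebra_simps)
  qed
  then show ?thesis using C D by (intro exI[of _ "2 * D * C"]) auto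
qed

subsection \<open>The space-time weight and the frequency strip\<close>

lemma integral_pair_mult:
  fixes f :: "'a \<Rightarrow> complex" and g :: "'b \<Rightarrow> complex"
  assumes M1: "sigma_finite_measure M1" and M2: "sigma_finite_measure M2"
    and f: "integrable M1 f" and g: "integrable M2 g"
  shows "integrable (M1 \<Otimes>\<^sub>M M2) (\<lambda>(x, y). f x * g y)"
    and "(\<integral>z. (case z of (x, y) \<Rightarrow> f x * g y) \<partial>(M1 \<Otimes>\<^sub>M M2)) = (\<integral>x. f x \<partial>M1) * (\<integral>y. g y \<partial>M2)"
proof -
  interpret M1: sigma_finite_measure M1 by fact
  interpret M2: sigma_finite_measure M2 by fact
  interpret pair_sigma_finite M1 M2 ..
  have [measurable]: "f \<in> borel_measurable M1" "g \<in> borel_measurable M2" using f g by auto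
  show int: "integrable (M1 \<Otimes>\<^sub>M M2) (\<lambda>(x, y). f x * g y)"
  proof (rule Fubini_integrable)
    show "integrable M1 (\<lambda>x. \<integral>y. norm (case (x, y) of (x, y) \<Rightarrow> f x * g y) \<partial>M2)"
      using f by (simp add: norm_mult)
    show "AE x in M1. integrable M2 (\<lambda>y. case (x, y) of (x, y) \<Rightarrow> f x * g y)"
      using g by simp
  qed measurable
  show "(\<integral>z. (case z of (x, y) \<Rightarrow> f x * g y) \<partial>(M1 \<Otimes>\<^sub>M M2)) = (\<integral>x. f x \<partial>M1) * (\<integral>y. g y \<partial>M2)"
    using integral_fst[OF int] by simp
qed

text \<open>Haar measure of the torus, carried by the representatives over which
  \<open>L4_pow4\<close> and \<open>L2_pow2\<close> integrate.\<close>

definition unit_uniform :: "real measure" where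
  "unit_uniform = density lborel (indicator {0..1})"

lemma sets_unit_uniform [simp, measurable_cong]: "sets unit_uniform = sets borel"
  by (simp add: unit_uniform_def)

lemma space_unit_uniform [simp]: "space unit_uniform = UNIV"
  by (simp add: unit_uniform_def)

lemma prob_space_unit_uniform: "prob_space unit_uniform"
  by standard (simp add: unit_uniform_def emeasure_density)

lemma nn_integral_unit_uniform:
  "f \<in> borel_measurable borel \<Longrightarrow> (\<integral>\<^sup>+ y. f y \<partial>unit_uniform) = (\<integral>\<^sup>+ y. indicator {0..1} y * f y \<partial>lborel)"
  unfolding unit_uniform_def by (subst nn_integral_density) auto

lemma integral_unit_uniform_cis:
  fixes k :: int
  shows "(\<integral>y. cis (2 * pi * real_of_int k * y) \<partial>unit_uniform) = of_bool (k = 0)"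
proof -
  interpret U: prob_space unit_uniform by (rule prob_space_unit_uniform)
  show ?thesis
  proof (cases "k = 0")
    case True
    then show ?thesis using U.prob_space by simp
  next
    case False
    define c where "c = 2 * pi * real_of_int k"
    have c: "c \<noteq> 0" using False by (simp add: c_def)
    have "(\<integral>y. cis (c * y) \<partial>unit_uniform) = (\<integral>y. indicator {0..1} y *\<^sub>R cis (c * y) \<partial>lborel)"
    proof -
      have eq: "unit_uniform = density lborel (\<lambda>x. ennreal (indicator {0..1} x))"
        unfolding unit_uniform_def by (simp add: ennreal_indicator)
      show ?thesis unfolding eq by (subst integral_density) auto
    qed
    also have "\<dots> = cis (c * 1) / (\<i> * c) - cis (c * 0) / (\<i> * c)"
    proof (rule integral_FTC_Icc)
      fix x :: real
      have "((\<lambda>y. cis (c * y)) has_vector_derivative c *\<^sub>R (\<i> * cis (c * x))) (at x within {0..1})"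
        by (auto intro!: derivative_eq_intros simp: has_vector_derivative_def scaleR_conv_of_real)
      then show "((\<lambda>y. cis (c * y) / (\<i> * c)) has_vector_derivative cis (c * x)) (at x within {0..1})"
        using c by (auto intro!: derivative_eq_intros simp: has_vector_derivative_divide scaleR_conv_of_real)
    qed (auto intro!: continuous_intros)
    also have "\<dots> = 0"
    proof -
      have "cis c = 1" unfolding c_def using cis_multiple_2pi[of "real_of_int k"] by (simp add: mult_ac)
      then show ?thesis by simp
    qed
    finally show ?thesis using False by (simp add: c_def)
  qed
qed

text \<open>Points are ordered as \<open>(x, t, y)\<close>: x stands first because the wide Gaussian
  limit is taken in x after t and y have been integrated out.\<close>

definition spacetime :: "(real \<times> real \<times> real) measure" where
  "spacetime = std_normal_distribution \<Otimes>\<^sub>M (std_normal_distribution \<Otimes>\<^sub>M unit_uniform)"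

lemma prob_space_spacetime: "prob_space spacetime"
  unfolding spacetime_def by (intro prob_space_pair prob_space_std_normal prob_space_unit_uniform)

lemma sets_spacetime [simp, measurable_cong]: "sets spacetime = sets (borel \<Otimes>\<^sub>M (borel \<Otimes>\<^sub>M borel))"
  unfolding spacetime_def by (intro sets_pair_measure_cong) auto

lemma space_spacetime [simp]: "space spacetime = UNIV"
  unfolding spacetime_def by (simp add: space_pair_measure)

lemma integral_spacetime_cis:
  "(\<integral>s. (case s of (x, t, y) \<Rightarrow> cis (b * x + a * t + 2 * pi * real_of_int k * y)) \<partial>spacetime)
     = complex_of_real (exp (- (b\<^sup>2) / 2) * exp (- (a\<^sup>2) / 2) * of_bool (k = 0))"
proof -
  interpret N: prob_space std_normal_distribution by (rule prob_space_std_normal)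
  interpret U: prob_space unit_uniform by (rule prob_space_unit_uniform)
  interpret NU: prob_space "std_normal_distribution \<Otimes>\<^sub>M unit_uniform"
    by (intro prob_space_pair prob_space_std_normal prob_space_unit_uniform)
  have iN: "integrable std_normal_distribution (\<lambda>x. cis (c * x))" for c
    by (rule N.integrable_const_bound[where B = 1]) auto
  have iU: "integrable unit_uniform (\<lambda>x. cis (c * x))" for c
    by (rule U.integrable_const_bound[where B = 1]) auto
  note NU = integral_pair_mult[OF N.sigma_finite_measure_axioms U.sigma_finite_measure_axioms iN[of a] iU[of "2 * pi * real_of_int k"]]
  note NNU = integral_pair_mult[OF N.sigma_finite_measure_axioms NU.sigma_finite_measure_axioms iN[of b] NU(1)]
  have "cis (b * x + a * t + 2 * pi * real_of_int k * y) = cis (b * x) * (cis (a * t) * cis (2 * pi * real_of_int k * y))" for x t y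
    by (simp add: cis_mult algebra_simps)
  then have "(\<integral>s. (case s of (x, t, y) \<Rightarrow> cis (b * x + a * t + 2 * pi * real_of_int k * y)) \<partial>spacetime)
      = (\<integral>s. (case s of (x, z) \<Rightarrow> cis (b * x) * (case z of (t, y) \<Rightarrow> cis (a * t) * cis (2 * pi * real_of_int k * y))) \<partial>spacetime)"
    by (simp add: split_beta')
  also have "\<dots> = complex_of_real (exp (- (b\<^sup>2) / 2) * exp (- (a\<^sup>2) / 2) * of_bool (k = 0))"
    unfolding spacetime_def NNU(2) NU(2) integral_std_normal_cis integral_unit_uniform_cis by simp
  finally show ?thesis .
qed

text \<open>Restricting k to a finite set turns frequency integrals into finite sums. \<xi> stays
  unrestricted; its bounded range is carried by the data.\<close>

definition freq_strip :: "real \<Rightarrow> (real \<times> int) measure" where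
  "freq_strip N = lborel \<Otimes>\<^sub>M count_space (freq_box N)"

lemma sets_freq_strip [measurable_cong]: "sets (freq_strip N) = sets (borel \<Otimes>\<^sub>M count_space (freq_box N))"
  unfolding freq_strip_def by (intro sets_pair_measure_cong) auto

lemma sigma_finite_freq_strip: "sigma_finite_measure (freq_strip N)"
proof -
  interpret C: sigma_finite_measure "count_space (freq_box N)"
    by (rule sigma_finite_measure_count_space_finite) simp
  interpret pair_sigma_finite lborel "count_space (freq_box N)" ..
  show ?thesis unfolding freq_strip_def by (rule sigma_finite_measure_axioms)
qed

lemma nn_integral_freq_strip:
  assumes [measurable]: "f \<in> borel_measurable (freq_strip N)"
  shows "(\<integral>\<^sup>+ p. f p \<partial>freq_strip N) = (\<Sum>k\<in>freq_box N. \<integral>\<^sup>+ \<xi>. f (\<xi>, k) \<partial>lborel)"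
proof -
  interpret C: sigma_finite_measure "count_space (freq_box N)"
    by (rule sigma_finite_measure_count_space_finite) simp
  interpret pair_sigma_finite lborel "count_space (freq_box N)" ..
  have [measurable]: "f \<in> borel_measurable (lborel \<Otimes>\<^sub>M count_space (freq_box N))"
    using assms by (simp add: freq_strip_def)
  show ?thesis
    unfolding freq_strip_def
    by (subst nn_integral_snd[symmetric]) (auto simp: nn_integral_count_space_finite)
qed

lemma integral_freq_strip:
  fixes f :: "real \<times> int \<Rightarrow> complex"
  assumes f: "integrable (freq_strip N) f"
  shows "(\<integral>p. f p \<partial>freq_strip N) = (\<Sum>k\<in>freq_box N. \<integral>\<xi>. f (\<xi>, k) \<partial>lborel)"
proof -
  interpret C: sigma_finite_measure "count_space (freq_box N)"
    by (rule sigma_finite_measure_count_space_finite) simp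
  interpret pair_sigma_finite lborel "count_space (freq_box N)" ..
  have "integrable (lborel \<Otimes>\<^sub>M count_space (freq_box N)) (\<lambda>(\<xi>, k). f (\<xi>, k))"
    using f by (simp add: freq_strip_def)
  from integral_snd[OF this] show ?thesis
    by (simp add: freq_strip_def lebesgue_integral_count_space_finite)
qed

subsection \<open>The bilinear kernel\<close>

lemma borel_measurable_real_of_int_count_space [measurable]:
  "real_of_int \<in> borel_measurable (count_space A)"
  by simp

text \<open>The dilation by \<sigma> sits in the wave so that the measure \<open>spacetime\<close>
  need not depend on it; at \<sigma> = 1 this is the plane wave solving the equation.\<close>

definition wave :: "real \<Rightarrow> (real \<times> real \<times> real) \<times> (real \<times> int) \<Rightarrow> complex" where
  "wave \<sigma> = (\<lambda>((x, t, y), (\<xi>, k)).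
     cis (2 * pi * (\<xi> * (\<sigma> * x) + real_of_int k * y) - 4 * pi\<^sup>2 * t * (\<xi>\<^sup>2 - (real_of_int k)\<^sup>2)))"

lemma borel_measurable_wave [measurable]: "wave \<sigma> \<in> borel_measurable (spacetime \<Otimes>\<^sub>M freq_strip N)"
  unfolding wave_def split_beta' by measurable

lemma norm_wave [simp]: "norm (wave \<sigma> z) = 1"
  by (simp add: wave_def split_beta)

text \<open>The phase of a product of two waves depends on t through -4 pi^2 t times this
  quantity.\<close>

definition resonance :: "(real \<times> int) \<times> (real \<times> int) \<Rightarrow> real" where
  "resonance = (\<lambda>((\<xi>\<^sub>1, k\<^sub>1), (\<xi>\<^sub>2, k\<^sub>2)). (\<xi>\<^sub>1\<^sup>2 - (real_of_int k\<^sub>1)\<^sup>2) + (\<xi>\<^sub>2\<^sup>2 - (real_of_int k\<^sub>2)\<^sup>2))"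

text \<open>The three factors come from integrating in x, in t and in y;
  \<open>integral_wave_kernel\<close> identifies the product.\<close>

definition bikernel :: "real \<Rightarrow> (real \<times> int) \<times> (real \<times> int) \<Rightarrow> (real \<times> int) \<times> (real \<times> int) \<Rightarrow> real" where
  "bikernel \<sigma> p q =
     exp (- ((2 * pi * \<sigma> * (fst (fst p) + fst (snd p) - (fst (fst q) + fst (snd q))))\<^sup>2) / 2)
     * exp (- ((4 * pi\<^sup>2 * (resonance q - resonance p))\<^sup>2) / 2)
     * of_bool (snd (fst p) + snd (snd p) = snd (fst q) + snd (snd q))"

lemma borel_measurable_bikernel:
  "case_prod (bikernel \<sigma>) \<in> borel_measurable ((freq_strip N \<Otimes>\<^sub>M freq_strip N) \<Otimes>\<^sub>M (freq_strip N \<Otimes>\<^sub>M freq_strip N))"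
proof -
  \<comment> \<open>The integer constraint is restated over the reals, where measurability of the
    comparison is standard.\<close>
  have eq: "of_bool (i + j = k + l) = (if real_of_int i + real_of_int j = real_of_int k + real_of_int l then 1 else 0 :: real)" for i j k l
    by (simp flip: of_int_add)
  show ?thesis
    unfolding bikernel_def resonance_def eq split_beta' by measurable
qed

lemma bikernel_sym: "bikernel \<sigma> p q = bikernel \<sigma> q p"
  unfolding bikernel_def
  by (simp only: power_mult_distrib power2_commute[of "fst (fst p) + fst (snd p)"]
      power2_commute[of "resonance q"] eq_commute[of "snd (fst p) + snd (snd p)"])

lemma integral_wave_kernel:
  "(\<integral>s. (wave \<sigma> (s, fst p) * wave \<sigma> (s, snd p)) * cnj (wave \<sigma> (s, fst q) * wave \<sigma> (s, snd q)) \<partial>spacetime)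
     = complex_of_real (bikernel \<sigma> p q)"
proof -
  obtain \<xi>1 k1 \<xi>2 k2 where p: "p = ((\<xi>1, k1), (\<xi>2, k2))" by (metis prod.exhaust)
  obtain \<eta>1 l1 \<eta>2 l2 where q: "q = ((\<eta>1, l1), (\<eta>2, l2))" by (metis prod.exhaust)
  define b where "b = 2 * pi * \<sigma> * (\<xi>1 + \<xi>2 - (\<eta>1 + \<eta>2))"
  define a where "a = 4 * pi\<^sup>2 * (resonance q - resonance p)"
  define k where "k = k1 + k2 - (l1 + l2)"
  have "(wave \<sigma> (s, fst p) * wave \<sigma> (s, snd p)) * cnj (wave \<sigma> (s, fst q) * wave \<sigma> (s, snd q))
      = (case s of (x, t, y) \<Rightarrow> cis (b * x + a * t + 2 * pi * real_of_int k * y))" for s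
  proof (cases s)
    case (fields x t y)
    show ?thesis
      unfolding fields p q wave_def prod.case fst_conv snd_conv cis_mult cis_mult_cnj
      by (rule arg_cong[where f = cis])
         (simp add: a_def b_def k_def resonance_def p q algebra_simps)
  qed
  then have "(\<integral>s. (wave \<sigma> (s, fst p) * wave \<sigma> (s, snd p)) * cnj (wave \<sigma> (s, fst q) * wave \<sigma> (s, snd q)) \<partial>spacetime)
     = complex_of_real (exp (- (b\<^sup>2) / 2) * exp (- (a\<^sup>2) / 2) * of_bool (k = 0))"
    unfolding integral_spacetime_cis[symmetric] by presburger
  also have "\<dots> = complex_of_real (bikernel \<sigma> p q)"
    unfolding bikernel_def a_def b_def k_def by (simp add: p q)
  finally show ?thesis .
qed

lemma nn_integral_translate:
  fixes f :: "real \<Rightarrow> ennreal"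
  assumes "f \<in> borel_measurable borel"
  shows "(\<integral>\<^sup>+ x. f (c + x) \<partial>lborel) = (\<integral>\<^sup>+ x. f x \<partial>lborel)"
  using nn_integral_real_affine[OF assms, of 1 c] by simp

text \<open>
  For a pair with total frequency \<open>(\<eta>, k)\<close> the resonance function is
  \<open>2a\<^sup>2 - 2b\<^sup>2 + (\<eta>\<^sup>2 - k\<^sup>2)/2\<close> in the centred variables \<open>a = \<eta>\<^sub>1 - \<eta>/2\<close>, \<open>b = l - k/2\<close>.
\<close>

lemma nn_integral_bikernel_le:
  fixes A :: ennreal
  assumes \<sigma>: "\<sigma> > 0"
    and A: "\<And>c \<tau>. (\<Sum>k\<in>freq_box N. \<integral>\<^sup>+ a. ennreal (exp (- ((a\<^sup>2 - ((real_of_int k - c)\<^sup>2 + \<tau>))\<^sup>2))) \<partial>lborel) \<le> A"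
  shows "(\<integral>\<^sup>+ q. ennreal (bikernel \<sigma> p q) \<partial>(freq_strip N \<Otimes>\<^sub>M freq_strip N)) \<le> A * ennreal (1 / (\<sigma> * sqrt (2 * pi)))"
proof -
  interpret S: sigma_finite_measure "freq_strip N" by (rule sigma_finite_freq_strip)
  define \<xi> where "\<xi> = fst (fst p) + fst (snd p)"
  define k where "k = snd (fst p) + snd (snd p)"
  define w where "w = resonance p"
  define E where "E = (\<lambda>l \<eta>1 \<eta>2. ennreal (exp (- ((2 * pi * \<sigma> * (\<xi> - (\<eta>1 + \<eta>2)))\<^sup>2) / 2)
     * exp (- ((4 * pi\<^sup>2 * (\<eta>1\<^sup>2 + \<eta>2\<^sup>2 - (real_of_int l)\<^sup>2 - (real_of_int (k - l))\<^sup>2 - w))\<^sup>2) / 2)))"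
  have Em: "(\<lambda>z. E l (fst z) (snd z)) \<in> borel_measurable (borel \<Otimes>\<^sub>M borel)" for l
    unfolding E_def by measurable
  have Em1[measurable]: "(\<lambda>x. E l (f x) (g x)) \<in> borel_measurable M"
    if [measurable]: "f \<in> borel_measurable M" "g \<in> borel_measurable M" for l f g and M :: "'z measure"
    using measurable_compose[OF measurable_Pair[OF that] Em[of l]] by simp
  \<comment> \<open>Setting the resonance in centred variables equal to w and solving for a^2 gives
    this level. Thus \<open>J\<close> is a slice in the hypothesis on \<open>A\<close> with centre
    k/2 and a \<tau> depending on \<eta>.\<close>
  define J where "J = (\<lambda>l \<eta>. \<integral>\<^sup>+ a. ennreal (exp (- ((a\<^sup>2 - ((real_of_int l - real_of_int k / 2)\<^sup>2
      + (w - \<eta>\<^sup>2 / 2 + (real_of_int k)\<^sup>2 / 2) / 2))\<^sup>2))) \<partial>lborel)"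
  define G where "G = (\<lambda>\<eta>. ennreal (exp (- ((2 * pi * \<sigma> * (\<xi> - \<eta>))\<^sup>2) / 2)))"
  have Gm[measurable]: "G \<in> borel_measurable borel" unfolding G_def by measurable
  have Jm[measurable]: "J l \<in> borel_measurable borel" for l unfolding J_def by measurable
  have bm: "(\<lambda>q. ennreal (bikernel \<sigma> p q)) \<in> borel_measurable (freq_strip N \<Otimes>\<^sub>M freq_strip N)"
  proof -
    have eq: "of_bool (i + j = k + l) = (if real_of_int i + real_of_int j = real_of_int k + real_of_int l then 1 else 0 :: real)" for i j k l
      by (simp flip: of_int_add)
    show ?thesis unfolding bikernel_def resonance_def eq split_beta' by measurable
  qed
  have kE: "ennreal (bikernel \<sigma> p ((\<eta>1, l1), (\<eta>2, l2))) = (if l2 = k - l1 then E l1 \<eta>1 \<eta>2 else 0)" for \<eta>1 l1 \<eta>2 l2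
  proof (cases "l2 = k - l1")
    case True
    have "resonance ((\<eta>1, l1), (\<eta>2, l2)) - resonance p
        = \<eta>1\<^sup>2 + \<eta>2\<^sup>2 - (real_of_int l1)\<^sup>2 - (real_of_int (k - l1))\<^sup>2 - w"
      unfolding True w_def by (simp add: resonance_def)
    moreover have "snd (fst p) + snd (snd p) = l1 + l2" using True by (simp add: k_def)
    ultimately show ?thesis using True by (simp add: bikernel_def E_def \<xi>_def)
  next
    case False
    then show ?thesis by (auto simp: bikernel_def k_def)
  qed
  have pair: "(\<integral>\<^sup>+ \<eta>1. \<integral>\<^sup>+ \<eta>2. E l \<eta>1 \<eta>2 \<partial>lborel \<partial>lborel) \<le> (\<integral>\<^sup>+ \<eta>. G \<eta> * J l \<eta> \<partial>lborel)" for l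
  proof -
    \<comment> \<open>The first translation makes the total frequency \<eta> a variable; the second,
      after Fubini, centres \<eta>1 at \<eta>/2.\<close>
    have "(\<integral>\<^sup>+ \<eta>1. \<integral>\<^sup>+ \<eta>2. E l \<eta>1 \<eta>2 \<partial>lborel \<partial>lborel) = (\<integral>\<^sup>+ \<eta>1. \<integral>\<^sup>+ \<eta>. E l \<eta>1 (- \<eta>1 + \<eta>) \<partial>lborel \<partial>lborel)"
      by (intro nn_integral_cong nn_integral_translate[symmetric]) measurable
    also have "\<dots> = (\<integral>\<^sup>+ \<eta>. \<integral>\<^sup>+ \<eta>1. E l \<eta>1 (- \<eta>1 + \<eta>) \<partial>lborel \<partial>lborel)"
      by (rule lborel_pair.Fubini'[symmetric]) measurable
    also have "\<dots> = (\<integral>\<^sup>+ \<eta>. \<integral>\<^sup>+ a. E l (\<eta> / 2 + a) (- (\<eta> / 2 + a) + \<eta>) \<partial>lborel \<partial>lborel)"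
      by (intro nn_integral_cong nn_integral_translate[symmetric]) measurable
    also have "\<dots> \<le> (\<integral>\<^sup>+ \<eta>. \<integral>\<^sup>+ a. G \<eta> * ennreal (exp (- ((a\<^sup>2 - ((real_of_int l - real_of_int k / 2)\<^sup>2
      + (w - \<eta>\<^sup>2 / 2 + (real_of_int k)\<^sup>2 / 2) / 2))\<^sup>2))) \<partial>lborel \<partial>lborel)"
    proof (intro nn_integral_mono)
      fix \<eta> a :: real
      define X where "X = a\<^sup>2 - ((real_of_int l - real_of_int k / 2)\<^sup>2 + (w - \<eta>\<^sup>2 / 2 + (real_of_int k)\<^sup>2 / 2) / 2)"
      have eq: "(\<eta> / 2 + a)\<^sup>2 + (- (\<eta> / 2 + a) + \<eta>)\<^sup>2 - (real_of_int l)\<^sup>2 - (real_of_int (k - l))\<^sup>2 - w = 2 * X"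
        by (simp add: X_def power2_eq_square field_simps)
      \<comment> \<open>The time factor has exponent -2 (4 pi^2)^2 X^2, which is at most -X^2, the
        exponent in \<open>J\<close>.\<close>
      have p2: "1 \<le> pi\<^sup>2" using pi_gt3 by (simp add: one_le_power)
      have "1 * X\<^sup>2 \<le> (4 * pi\<^sup>2)\<^sup>2 * 2 * X\<^sup>2"
      proof (rule mult_right_mono)
        have "1 \<le> (4 * pi\<^sup>2)\<^sup>2" using p2 by (intro one_le_power) auto
        then show "1 \<le> (4 * pi\<^sup>2)\<^sup>2 * 2" by linarith
      qed simp
      then have "exp (- ((4 * pi\<^sup>2 * (2 * X))\<^sup>2) / 2) \<le> exp (- (X\<^sup>2))"
        by (simp add: power_mult_distrib mult_ac)
      then have "exp (- ((2 * pi * \<sigma> * (\<xi> - \<eta>))\<^sup>2) / 2) * exp (- ((4 * pi\<^sup>2 * (2 * X))\<^sup>2) / 2)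
        \<le> exp (- ((2 * pi * \<sigma> * (\<xi> - \<eta>))\<^sup>2) / 2) * exp (- (X\<^sup>2))"
        by (intro mult_left_mono) auto
      then show "E l (\<eta> / 2 + a) (- (\<eta> / 2 + a) + \<eta>) \<le> G \<eta> * ennreal (exp (- ((a\<^sup>2 - ((real_of_int l - real_of_int k / 2)\<^sup>2
          + (w - \<eta>\<^sup>2 / 2 + (real_of_int k)\<^sup>2 / 2) / 2))\<^sup>2)))"
        unfolding E_def G_def eq X_def[symmetric] by (subst ennreal_mult[symmetric]) (auto intro!: ennreal_leI)
    qed
    also have "\<dots> = (\<integral>\<^sup>+ \<eta>. G \<eta> * J l \<eta> \<partial>lborel)"
      unfolding J_def by (intro nn_integral_cong nn_integral_cmult) measurable
    finally show ?thesis .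
  qed
  have "(\<integral>\<^sup>+ q. ennreal (bikernel \<sigma> p q) \<partial>(freq_strip N \<Otimes>\<^sub>M freq_strip N))
     = (\<integral>\<^sup>+ q1. \<integral>\<^sup>+ q2. ennreal (bikernel \<sigma> p (q1, q2)) \<partial>freq_strip N \<partial>freq_strip N)"
    by (rule S.nn_integral_fst[symmetric, OF bm])
  also have "\<dots> = (\<Sum>l1\<in>freq_box N. \<integral>\<^sup>+ \<eta>1. \<integral>\<^sup>+ q2. ennreal (bikernel \<sigma> p ((\<eta>1, l1), q2)) \<partial>freq_strip N \<partial>lborel)"
    by (rule nn_integral_freq_strip) (rule S.borel_measurable_nn_integral_fst[OF bm])
  also have "\<dots> \<le> (\<Sum>l1\<in>freq_box N. \<integral>\<^sup>+ \<eta>1. \<integral>\<^sup>+ \<eta>2. E l1 \<eta>1 \<eta>2 \<partial>lborel \<partial>lborel)"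
  proof (intro sum_mono nn_integral_mono)
    fix l1 and \<eta>1 :: real assume l1: "l1 \<in> freq_box N"
    have "(\<lambda>q2. ennreal (bikernel \<sigma> p ((\<eta>1, l1), q2))) \<in> borel_measurable (freq_strip N)"
      using l1 by (intro measurable_compose[OF measurable_Pair1' bm]) (simp add: freq_strip_def space_pair_measure)
    then have "(\<integral>\<^sup>+ q2. ennreal (bikernel \<sigma> p ((\<eta>1, l1), q2)) \<partial>freq_strip N)
       = (\<Sum>l2\<in>freq_box N. \<integral>\<^sup>+ \<eta>2. ennreal (bikernel \<sigma> p ((\<eta>1, l1), (\<eta>2, l2))) \<partial>lborel)"
      by (rule nn_integral_freq_strip)
    also have "\<dots> = (\<Sum>l2\<in>freq_box N. if l2 = k - l1 then \<integral>\<^sup>+ \<eta>2. E l1 \<eta>1 \<eta>2 \<partial>lborel else 0)"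
      unfolding kE by (intro sum.cong) auto
    \<comment> \<open>Only \<open>l2 = k - l1\<close> survives, and it may lie outside the box,
      hence an inequality.\<close>
    also have "\<dots> \<le> (\<integral>\<^sup>+ \<eta>2. E l1 \<eta>1 \<eta>2 \<partial>lborel)"
      by (simp add: sum.delta)
    finally show "(\<integral>\<^sup>+ q2. ennreal (bikernel \<sigma> p ((\<eta>1, l1), q2)) \<partial>freq_strip N) \<le> (\<integral>\<^sup>+ \<eta>2. E l1 \<eta>1 \<eta>2 \<partial>lborel)" .
  qed
  also have "\<dots> \<le> (\<Sum>l1\<in>freq_box N. \<integral>\<^sup>+ \<eta>. G \<eta> * J l1 \<eta> \<partial>lborel)"
    by (intro sum_mono pair)
  also have "\<dots> = (\<integral>\<^sup>+ \<eta>. (\<Sum>l1\<in>freq_box N. G \<eta> * J l1 \<eta>) \<partial>lborel)"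
    by (rule nn_integral_sum[symmetric]) measurable
  also have "\<dots> \<le> (\<integral>\<^sup>+ \<eta>. A * G \<eta> \<partial>lborel)"
  proof (rule nn_integral_mono)
    fix \<eta> :: real
    have "(\<Sum>l1\<in>freq_box N. G \<eta> * J l1 \<eta>) = G \<eta> * (\<Sum>l1\<in>freq_box N. J l1 \<eta>)"
      by (rule sum_distrib_left[symmetric])
    also have "\<dots> \<le> G \<eta> * A"
      unfolding J_def by (intro mult_left_mono A) simp
    finally show "(\<Sum>l1\<in>freq_box N. G \<eta> * J l1 \<eta>) \<le> A * G \<eta>" by (simp add: mult.commute)
  qed
  also have "\<dots> = A * (\<integral>\<^sup>+ \<eta>. G \<eta> \<partial>lborel)"
    by (rule nn_integral_cmult) measurable
  also have "(\<integral>\<^sup>+ \<eta>. G \<eta> \<partial>lborel) = ennreal (sqrt (2 * pi) / (2 * pi * \<sigma>))"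
    unfolding G_def by (rule nn_integral_gauss) (use \<sigma> in simp)
  also have "sqrt (2 * pi) / (2 * pi * \<sigma>) = 1 / (\<sigma> * sqrt (2 * pi))"
    using \<sigma> by (simp add: divide_simps)
  finally show ?thesis .
qed

section \<open>The L4 estimate in terms of the frequency norm\<close>

lemma integrable_wave_mult:
  assumes F: "integrable (freq_strip N) F"
  shows "integrable (freq_strip N) (\<lambda>p. wave \<sigma> (s, p) * F p)"
proof (rule Bochner_Integration.integrable_bound[OF F])
  have [measurable]: "F \<in> borel_measurable (freq_strip N)" using F by auto
  have "(\<lambda>p. wave \<sigma> (s, p)) \<in> borel_measurable (freq_strip N)"
    by (rule measurable_compose[OF measurable_Pair1' borel_measurable_wave]) simp
  then show "(\<lambda>p. wave \<sigma> (s, p) * F p) \<in> borel_measurable (freq_strip N)" by measurable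
qed (simp add: norm_mult)

text \<open>The fourth power is the squared modulus of the square, and the square is linear in the
  tensor product of F with itself. Schur's test on pairs of frequencies therefore applies, and the
  norm of the tensor product factors.\<close>

lemma spacetime_L4_bound:
  fixes A :: ennreal
  assumes F: "integrable (freq_strip N) F" and \<sigma>: "\<sigma> > 0"
    and A: "\<And>c \<tau>. (\<Sum>k\<in>freq_box N. \<integral>\<^sup>+ a. ennreal (exp (- ((a\<^sup>2 - ((real_of_int k - c)\<^sup>2 + \<tau>))\<^sup>2))) \<partial>lborel) \<le> A"
  shows "(\<integral>\<^sup>+ s. ennreal (norm (\<integral>p. wave \<sigma> (s, p) * F p \<partial>freq_strip N) ^ 4) \<partial>spacetime)
      \<le> A * ennreal (1 / (\<sigma> * sqrt (2 * pi))) * (\<integral>\<^sup>+ p. ennreal (norm (F p) ^ 2) \<partial>freq_strip N) ^ 2"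
proof -
  interpret S: sigma_finite_measure "freq_strip N" by (rule sigma_finite_freq_strip)
  interpret SS: pair_sigma_finite "freq_strip N" "freq_strip N" ..
  have [measurable]: "F \<in> borel_measurable (freq_strip N)" using F by auto
  define e where "e = (\<lambda>z. wave \<sigma> (fst z, fst (snd z)) * wave \<sigma> (fst z, snd (snd z)))"
  define G where "G = (\<lambda>(p, q). F p * F q)"
  have em: "e \<in> borel_measurable (spacetime \<Otimes>\<^sub>M (freq_strip N \<Otimes>\<^sub>M freq_strip N))"
    unfolding e_def by measurable
  have Gi: "integrable (freq_strip N \<Otimes>\<^sub>M freq_strip N) G"
    unfolding G_def by (rule integral_pair_mult(1)[OF sigma_finite_freq_strip sigma_finite_freq_strip F F])
  have "(\<integral>\<^sup>+ s. ennreal (norm (\<integral>p. e (s, p) * G p \<partial>(freq_strip N \<Otimes>\<^sub>M freq_strip N)) ^ 2) \<partial>spacetime)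
     \<le> A * ennreal (1 / (\<sigma> * sqrt (2 * pi))) * (\<integral>\<^sup>+ p. ennreal (norm (G p) ^ 2) \<partial>(freq_strip N \<Otimes>\<^sub>M freq_strip N))"
  proof (rule TTstar_Schur[OF SS.sigma_finite_measure_axioms prob_space_spacetime em _ Gi borel_measurable_bikernel[of \<sigma>]])
    show "norm (e z) \<le> 1" for z by (simp add: e_def norm_mult)
    show "norm (\<integral>s. e (s, p) * cnj (e (s, q)) \<partial>spacetime) \<le> bikernel \<sigma> p q" for p q
    proof -
      have "0 \<le> bikernel \<sigma> p q" by (simp add: bikernel_def)
      then show ?thesis unfolding e_def fst_conv snd_conv integral_wave_kernel by simp
    qed
    show "bikernel \<sigma> p q = bikernel \<sigma> q p" for p q by (rule bikernel_sym)
    show "(\<integral>\<^sup>+ q. ennreal (bikernel \<sigma> p q) \<partial>(freq_strip N \<Otimes>\<^sub>M freq_strip N)) \<le> A * ennreal (1 / (\<sigma> * sqrt (2 * pi)))" for p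
      by (rule nn_integral_bikernel_le[OF \<sigma> A])
  qed
  also have "(\<integral>\<^sup>+ p. ennreal (norm (G p) ^ 2) \<partial>(freq_strip N \<Otimes>\<^sub>M freq_strip N))
      = (\<integral>\<^sup>+ p. \<integral>\<^sup>+ q. ennreal (norm (G (p, q)) ^ 2) \<partial>freq_strip N \<partial>freq_strip N)"
    by (rule S.nn_integral_fst[symmetric]) (use Gi in measurable)
  also have "\<dots> = (\<integral>\<^sup>+ p. \<integral>\<^sup>+ q. ennreal (norm (F p) ^ 2) * ennreal (norm (F q) ^ 2) \<partial>freq_strip N \<partial>freq_strip N)"
    unfolding G_def by (simp add: norm_mult power_mult_distrib ennreal_mult)
  also have "\<dots> = (\<integral>\<^sup>+ p. ennreal (norm (F p) ^ 2) \<partial>freq_strip N) ^ 2"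
    by (simp add: nn_integral_cmult nn_integral_multc power2_eq_square)
  finally have bd: "(\<integral>\<^sup>+ s. ennreal (norm (\<integral>p. e (s, p) * G p \<partial>(freq_strip N \<Otimes>\<^sub>M freq_strip N)) ^ 2) \<partial>spacetime)
     \<le> A * ennreal (1 / (\<sigma> * sqrt (2 * pi))) * (\<integral>\<^sup>+ p. ennreal (norm (F p) ^ 2) \<partial>freq_strip N) ^ 2" .
  have sq: "(\<integral>p. e (s, p) * G p \<partial>(freq_strip N \<Otimes>\<^sub>M freq_strip N)) = (\<integral>p. wave \<sigma> (s, p) * F p \<partial>freq_strip N) ^ 2" for s
  proof -
    have "(\<integral>p. e (s, p) * G p \<partial>(freq_strip N \<Otimes>\<^sub>M freq_strip N))
        = (\<integral>z. (case z of (p, q) \<Rightarrow> (wave \<sigma> (s, p) * F p) * (wave \<sigma> (s, q) * F q)) \<partial>(freq_strip N \<Otimes>\<^sub>M freq_strip N))"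
      by (intro Bochner_Integration.integral_cong) (auto simp: e_def G_def)
    also have "\<dots> = (\<integral>p. wave \<sigma> (s, p) * F p \<partial>freq_strip N) * (\<integral>p. wave \<sigma> (s, p) * F p \<partial>freq_strip N)"
      by (intro integral_pair_mult(2) sigma_finite_freq_strip integrable_wave_mult F)
    finally show ?thesis by (simp add: power2_eq_square)
  qed
  show ?thesis using bd unfolding sq by (simp add: norm_power flip: power_mult)
qed

lemma wave_scale: "wave \<sigma> ((x, t, y), p) = wave 1 ((\<sigma> * x, t, y), p)"
  by (simp add: wave_def split_beta)

text \<open>Removes both Gaussian weights. In t the indicator of the unit interval lies below a
  multiple of the density. In x the bound of \<open>spacetime_L4_bound\<close> decays exactly as
  fast as the weight spreads.\<close>

lemma strichartz_freq_bound:
  fixes A :: ennreal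
  assumes F: "integrable (freq_strip N) F"
    and A: "\<And>c \<tau>. (\<Sum>k\<in>freq_box N. \<integral>\<^sup>+ a. ennreal (exp (- ((a\<^sup>2 - ((real_of_int k - c)\<^sup>2 + \<tau>))\<^sup>2))) \<partial>lborel) \<le> A"
  defines "V \<equiv> \<lambda>t x y. \<integral>p. wave 1 ((x, t, y), p) * F p \<partial>freq_strip N"
  shows "(\<integral>\<^sup>+ t. indicator {0..1} t * (\<integral>\<^sup>+ x. (\<integral>\<^sup>+ y. indicator {0..1} y * ennreal (norm (V t x y) ^ 4) \<partial>lborel) \<partial>lborel) \<partial>lborel)
      \<le> ennreal (sqrt (2 * pi) * exp (1 / 2)) * (A * (\<integral>\<^sup>+ p. ennreal (norm (F p) ^ 2) \<partial>freq_strip N) ^ 2)"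
proof -
  interpret S: sigma_finite_measure "freq_strip N" by (rule sigma_finite_freq_strip)
  interpret N: prob_space std_normal_distribution by (rule prob_space_std_normal)
  interpret U: prob_space unit_uniform by (rule prob_space_unit_uniform)
  interpret NU: prob_space "std_normal_distribution \<Otimes>\<^sub>M unit_uniform"
    by (intro prob_space_pair prob_space_std_normal prob_space_unit_uniform)
  interpret NL: pair_sigma_finite std_normal_distribution "lborel :: real measure" ..
  have [measurable]: "F \<in> borel_measurable (freq_strip N)" using F by auto
  define Q where "Q = (\<lambda>s. ennreal (norm (\<integral>p. wave 1 (s, p) * F p \<partial>freq_strip N) ^ 4))"
  have Qm[measurable]: "Q \<in> borel_measurable (borel \<Otimes>\<^sub>M (borel \<Otimes>\<^sub>M borel))"
  proof -
    have "Q \<in> borel_measurable spacetime" unfolding Q_def by measurable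
    then show ?thesis by simp
  qed
  \<comment> \<open>The reciprocal of the standard normal density at t = 1, its minimum over the
    unit interval.\<close>
  define c where "c = sqrt (2 * pi) * exp (1 / 2)"
  have weight: "indicator {0..1} t \<le> ennreal c * ennreal (std_normal_density t)" for t :: real
  proof (cases "t \<in> {0..1}")
    case True
    then have "t\<^sup>2 \<le> 1" by (simp add: power_le_one)
    then have "1 \<le> exp (1 / 2 - t\<^sup>2 / 2)" by simp
    also have "\<dots> = exp (1 / 2) * exp (- (t\<^sup>2) / 2)" by (simp flip: exp_add add: diff_divide_distrib)
    also have "\<dots> = c * std_normal_density t" by (simp add: c_def std_normal_density_def)
    finally have "ennreal 1 \<le> ennreal (c * std_normal_density t)" by (rule ennreal_leI)
    then show ?thesis using True by (simp add: ennreal_mult c_def)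
  qed simp
  define X where "X = (\<lambda>t. \<integral>\<^sup>+ x. (\<integral>\<^sup>+ y. Q (x, t, y) \<partial>unit_uniform) \<partial>lborel)"
  have Xm[measurable]: "X \<in> borel_measurable borel" unfolding X_def by measurable
  have "(\<integral>\<^sup>+ t. indicator {0..1} t * (\<integral>\<^sup>+ x. (\<integral>\<^sup>+ y. indicator {0..1} y * ennreal (norm (V t x y) ^ 4) \<partial>lborel) \<partial>lborel) \<partial>lborel)
     = (\<integral>\<^sup>+ t. indicator {0..1} t * X t \<partial>lborel)"
  proof -
    have VQ: "ennreal (norm (V t x y) ^ 4) = Q (x, t, y)" for t x y by (simp add: V_def Q_def)
    show ?thesis unfolding VQ X_def by (subst nn_integral_unit_uniform) auto
  qed
  also have "\<dots> \<le> (\<integral>\<^sup>+ t. ennreal c * (ennreal (std_normal_density t) * X t) \<partial>lborel)"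
    by (intro nn_integral_mono) (metis weight mult.assoc mult_right_mono zero_le)
  also have "\<dots> = ennreal c * (\<integral>\<^sup>+ t. X t \<partial>std_normal_distribution)"
    by (simp add: nn_integral_cmult nn_integral_density)
  \<comment> \<open>x moves outermost, so that the weight in x can be inserted for the function left
    after integrating t and y.\<close>
  also have "(\<integral>\<^sup>+ t. X t \<partial>std_normal_distribution)
      = (\<integral>\<^sup>+ x. \<integral>\<^sup>+ t. \<integral>\<^sup>+ y. Q (x, t, y) \<partial>unit_uniform \<partial>std_normal_distribution \<partial>lborel)"
    unfolding X_def by (rule NL.Fubini'[symmetric]) measurable
  also have "\<dots> \<le> A * (\<integral>\<^sup>+ p. ennreal (norm (F p) ^ 2) \<partial>freq_strip N) ^ 2"
  proof (rule nn_integral_le_std_normal_scale)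
    fix \<sigma> :: real assume \<sigma>: "\<sigma> > 0"
    have "(\<integral>\<^sup>+ x. \<integral>\<^sup>+ t. \<integral>\<^sup>+ y. Q (\<sigma> * x, t, y) \<partial>unit_uniform \<partial>std_normal_distribution \<partial>std_normal_distribution)
       = (\<integral>\<^sup>+ x. \<integral>\<^sup>+ z. Q (\<sigma> * x, z) \<partial>(std_normal_distribution \<Otimes>\<^sub>M unit_uniform) \<partial>std_normal_distribution)"
      by (intro nn_integral_cong U.nn_integral_fst) measurable
    also have "\<dots> = (\<integral>\<^sup>+ s. Q (\<sigma> * fst s, snd s) \<partial>spacetime)"
      unfolding spacetime_def
      using NU.nn_integral_fst[of "\<lambda>s. Q (\<sigma> * fst s, snd s)" std_normal_distribution] by simp
    also have "\<dots> = (\<integral>\<^sup>+ s. ennreal (norm (\<integral>p. wave \<sigma> (s, p) * F p \<partial>freq_strip N) ^ 4) \<partial>spacetime)"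
      unfolding Q_def by (intro nn_integral_cong) (auto simp: wave_scale[of \<sigma>])
    also have "\<dots> \<le> A * ennreal (1 / (\<sigma> * sqrt (2 * pi))) * (\<integral>\<^sup>+ p. ennreal (norm (F p) ^ 2) \<partial>freq_strip N) ^ 2"
      by (rule spacetime_L4_bound[OF F \<sigma> A])
    finally have "ennreal (\<sigma> * sqrt (2 * pi)) * (\<integral>\<^sup>+ x. \<integral>\<^sup>+ t. \<integral>\<^sup>+ y. Q (\<sigma> * x, t, y) \<partial>unit_uniform \<partial>std_normal_distribution \<partial>std_normal_distribution)
       \<le> ennreal (\<sigma> * sqrt (2 * pi)) * (A * ennreal (1 / (\<sigma> * sqrt (2 * pi))) * (\<integral>\<^sup>+ p. ennreal (norm (F p) ^ 2) \<partial>freq_strip N) ^ 2)"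
      by (rule mult_left_mono) simp
    also have "\<dots> = (ennreal (\<sigma> * sqrt (2 * pi)) * ennreal (1 / (\<sigma> * sqrt (2 * pi)))) * (A * (\<integral>\<^sup>+ p. ennreal (norm (F p) ^ 2) \<partial>freq_strip N) ^ 2)"
      by (simp only: mult_ac)
    also have "ennreal (\<sigma> * sqrt (2 * pi)) * ennreal (1 / (\<sigma> * sqrt (2 * pi))) = 1"
      using \<sigma> by (simp flip: ennreal_mult)
    finally show "ennreal (\<sigma> * sqrt (2 * pi)) * (\<integral>\<^sup>+ x. \<integral>\<^sup>+ t. \<integral>\<^sup>+ y. Q (\<sigma> * x, t, y) \<partial>unit_uniform \<partial>std_normal_distribution \<partial>std_normal_distribution)
       \<le> A * (\<integral>\<^sup>+ p. ennreal (norm (F p) ^ 2) \<partial>freq_strip N) ^ 2" by simp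
  qed measurable
  finally show ?thesis
    unfolding c_def by (meson mult_left_mono order_trans zero_le order_refl)
qed

subsection \<open>Back to physical space\<close>

text \<open>The TT* identity with counting measure on the frequency side: orthogonality of
  characters makes the kernel the identity matrix.\<close>

lemma parseval_unit_uniform:
  fixes c :: "int \<Rightarrow> complex"
  assumes K: "finite K"
  shows "(\<integral>\<^sup>+ y. ennreal (norm (\<Sum>k\<in>K. cis (2 * pi * (real_of_int k * y)) * c k) ^ 2) \<partial>unit_uniform)
       = ennreal (\<Sum>k\<in>K. norm (c k) ^ 2)"
proof -
  have sf: "sigma_finite_measure (count_space K)"
    using K by (rule sigma_finite_measure_count_space_finite)
  have em: "(\<lambda>(y, k). cis (2 * pi * (real_of_int k * y))) \<in> borel_measurable (unit_uniform \<Otimes>\<^sub>M count_space K)"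
    by measurable
  have ci: "integrable (count_space K) c" using K by (simp add: integrable_count_space)
  have \<kappa>: "(\<integral>y. cis (2 * pi * (real_of_int p * y)) * cnj (cis (2 * pi * (real_of_int q * y))) \<partial>unit_uniform) = of_bool (p = q)" for p q
  proof -
    have "cis (2 * pi * (real_of_int p * y)) * cnj (cis (2 * pi * (real_of_int q * y))) = cis (2 * pi * real_of_int (p - q) * y)" for y
      unfolding cis_mult_cnj by (simp add: algebra_simps)
    then show ?thesis using integral_unit_uniform_cis[of "p - q"] by simp
  qed
  have "(\<integral>\<^sup>+ y. ennreal (norm (\<integral>k. cis (2 * pi * (real_of_int k * y)) * c k \<partial>count_space K) ^ 2) \<partial>unit_uniform)
     = ennreal (Re (\<integral>z. (case z of (p, q) \<Rightarrow> c p * cnj (c q) * of_bool (p = q)) \<partial>(count_space K \<Otimes>\<^sub>M count_space K)))"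
    by (rule TTstar_identity(2)[OF sf prob_space_unit_uniform em _ ci, unfolded prod.case \<kappa>]) auto
  also have "(\<integral>z. (case z of (p, q) \<Rightarrow> c p * cnj (c q) * of_bool (p = q)) \<partial>(count_space K \<Otimes>\<^sub>M count_space K))
     = (\<Sum>p\<in>K. \<Sum>q\<in>K. c p * cnj (c q) * of_bool (p = q))"
    using K by (simp only: pair_measure_count_space lebesgue_integral_count_space_finite
        finite_cartesian_product sum.cartesian_product)
  also have "\<dots> = (\<Sum>p\<in>K. c p * cnj (c p))"
    using K by (intro sum.cong refl) (simp add: of_bool_def if_distrib sum.delta' cong: if_cong)
  also have "\<dots> = complex_of_real (\<Sum>k\<in>K. norm (c k) ^ 2)"
    by (simp only: complex_norm_square[symmetric] of_real_sum)
  finally show ?thesis using K by (simp add: lebesgue_integral_count_space_finite)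
qed

section \<open>The cutoff and the localized data\<close>

lemma cutoff_continuous: "cutoff \<phi> \<Longrightarrow> continuous_on UNIV \<phi>"
  unfolding cutoff_def smooth_fun_def
  by (auto dest!: spec[of _ 0] intro: differentiable_imp_continuous_on)

text \<open>\<open>cutoff\<close> does not confine \<phi> to values between 0 and 1 where 1 < |x| <
  2, so the bound comes from compactness.\<close>

lemma cutoff_bounded:
  assumes "cutoff \<phi>"
  obtains B where "B > 0" "\<And>x. \<bar>\<phi> x\<bar> \<le> B"
proof -
  have "compact (\<phi> ` {-2..2})"
    by (intro compact_continuous_image continuous_on_subset[OF cutoff_continuous[OF assms]]) auto
  then obtain B where B: "B > 0" "\<And>x. x \<in> {-2..2} \<Longrightarrow> \<bar>\<phi> x\<bar> \<le> B"
    using compact_imp_bounded bounded_pos by (metis imageI real_norm_def)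
  have "\<bar>\<phi> x\<bar> \<le> B" for x
  proof (cases "\<bar>x\<bar> \<ge> 2")
    case True
    then show ?thesis using assms B(1) by (simp add: cutoff_def)
  next
    case False
    then show ?thesis by (intro B(2)) auto
  qed
  with B(1) that show thesis by blast
qed

text \<open>The Fourier transform of the frequency-localized data.\<close>

definition localized :: "(real \<Rightarrow> real) \<Rightarrow> real \<Rightarrow> (real \<times> int \<Rightarrow> complex) \<Rightarrow> real \<times> int \<Rightarrow> complex" where
  "localized \<phi> N g p = complex_of_real (PN_mult \<phi> N (fst p) (snd p)) * g p"

lemma PN_mult_eq_0:
  assumes "cutoff \<phi>" "N \<ge> 1" "\<bar>\<xi>\<bar> > 2 * N \<or> \<bar>real_of_int k\<bar> > 2 * N"
  shows "PN_mult \<phi> N \<xi> k = 0"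
proof -
  have "\<phi> (x / N) = 0" if "\<bar>x\<bar> > 2 * N" for x
    using assms(1,2) that by (simp add: cutoff_def abs_divide field_simps)
  then show ?thesis using assms(3) by (auto simp: PN_mult_def)
qed

text \<open>Localization puts L2 data into L1, as the TT* lemmas require: on the bounded support v
  \<le> 1 + v^2, and the support has finite measure.\<close>

lemma localized_L2:
  assumes \<phi>: "cutoff \<phi>" and N: "N \<ge> 1" and g: "L2_freq g"
  shows "localized \<phi> N g \<in> borel_measurable (freq_strip N)"
    and "(\<integral>\<^sup>+ p. ennreal (norm (localized \<phi> N g p) ^ 2) \<partial>freq_strip N) < \<infinity>"
    and "integrable (freq_strip N) (localized \<phi> N g)"
proof -
  have gm: "g \<in> borel_measurable freq_measure" and g2: "(\<integral>\<^sup>+ p. ennreal (norm (g p) ^ 2) \<partial>freq_measure) < \<infinity>"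
    using g by (auto simp: L2_freq_def)
  have [measurable]: "\<phi> \<in> borel_measurable borel"
    using cutoff_continuous[OF \<phi>] by (rule borel_measurable_continuous_onI)
  have [measurable]: "g \<in> borel_measurable (freq_strip N)"
  proof -
    have "snd \<in> freq_strip N \<rightarrow>\<^sub>M count_space UNIV"
      by (rule measurable_compose[where g = "\<lambda>k. k" and N = "count_space (freq_box N)"])
         (auto simp: freq_strip_def)
    then have "(\<lambda>p. (fst p, snd p)) \<in> freq_strip N \<rightarrow>\<^sub>M freq_measure"
      unfolding freq_measure_def by (intro measurable_Pair) (auto simp: freq_strip_def)
    from measurable_compose[OF this gm] show ?thesis by simp
  qed
  show Fm[measurable]: "localized \<phi> N g \<in> borel_measurable (freq_strip N)"
    unfolding localized_def PN_mult_def by measurable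
  obtain B where B: "B > 0" "\<And>x. \<bar>\<phi> x\<bar> \<le> B" using cutoff_bounded[OF \<phi>] by blast
  have PB: "\<bar>PN_mult \<phi> N \<xi> k\<bar> \<le> B * B" for \<xi> k
    unfolding PN_mult_def abs_mult using B by (intro mult_mono) auto
  interpret C: sigma_finite_measure "count_space (UNIV :: int set)"
    by (rule sigma_finite_measure_count_space)
  interpret P: pair_sigma_finite lborel "count_space (UNIV :: int set)" ..
  have "(\<integral>\<^sup>+ p. ennreal (norm (g p) ^ 2) \<partial>freq_strip N) = (\<Sum>k\<in>freq_box N. \<integral>\<^sup>+ \<xi>. ennreal (norm (g (\<xi>, k)) ^ 2) \<partial>lborel)"
    by (rule nn_integral_freq_strip) measurable
  also have "\<dots> = (\<integral>\<^sup>+ k. (\<integral>\<^sup>+ \<xi>. ennreal (norm (g (\<xi>, k)) ^ 2) \<partial>lborel) \<partial>count_space (freq_box N))"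
    by (simp add: nn_integral_count_space_finite)
  also have "\<dots> = (\<integral>\<^sup>+ k. (\<integral>\<^sup>+ \<xi>. ennreal (norm (g (\<xi>, k)) ^ 2) \<partial>lborel) * indicator (freq_box N) k \<partial>count_space UNIV)"
    by (rule nn_integral_count_space_indicator) simp
  also have "\<dots> \<le> (\<integral>\<^sup>+ k. (\<integral>\<^sup>+ \<xi>. ennreal (norm (g (\<xi>, k)) ^ 2) \<partial>lborel) \<partial>count_space UNIV)"
    by (intro nn_integral_mono) (simp add: indicator_def)
  also have "\<dots> = (\<integral>\<^sup>+ p. ennreal (norm (g p) ^ 2) \<partial>freq_measure)"
    unfolding freq_measure_def by (rule P.nn_integral_snd) (use gm in \<open>simp add: freq_measure_def\<close>)
  finally have gfin: "(\<integral>\<^sup>+ p. ennreal (norm (g p) ^ 2) \<partial>freq_strip N) < \<infinity>" using g2 by (rule le_less_trans)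
  have "(\<integral>\<^sup>+ p. ennreal (norm (localized \<phi> N g p) ^ 2) \<partial>freq_strip N)
     \<le> (\<integral>\<^sup>+ p. ennreal ((B * B) ^ 2) * ennreal (norm (g p) ^ 2) \<partial>freq_strip N)"
  proof (intro nn_integral_mono)
    fix p
    have "norm (localized \<phi> N g p) ^ 2 \<le> ((B * B) * norm (g p)) ^ 2"
      unfolding localized_def norm_mult norm_of_real
      by (intro power_mono mult_right_mono PB) auto
    then show "ennreal (norm (localized \<phi> N g p) ^ 2) \<le> ennreal ((B * B) ^ 2) * ennreal (norm (g p) ^ 2)"
      by (simp add: ennreal_leI power_mult_distrib flip: ennreal_mult)
  qed
  also have "\<dots> = ennreal ((B * B) ^ 2) * (\<integral>\<^sup>+ p. ennreal (norm (g p) ^ 2) \<partial>freq_strip N)"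
    by (rule nn_integral_cmult) measurable
  also have "\<dots> < \<infinity>" using gfin by (simp add: ennreal_mult_less_top)
  finally show F2: "(\<integral>\<^sup>+ p. ennreal (norm (localized \<phi> N g p) ^ 2) \<partial>freq_strip N) < \<infinity>" .
  have "(\<integral>\<^sup>+ p. ennreal (norm (localized \<phi> N g p)) \<partial>freq_strip N)
      \<le> (\<integral>\<^sup>+ p. indicator {-2 * N..2 * N} (fst p) + ennreal (norm (localized \<phi> N g p) ^ 2) \<partial>freq_strip N)"
  proof (intro nn_integral_mono)
    fix p
    show "ennreal (norm (localized \<phi> N g p)) \<le> indicator {-2 * N..2 * N} (fst p) + ennreal (norm (localized \<phi> N g p) ^ 2)"
    proof (cases "\<bar>fst p\<bar> > 2 * N")
      case True
      then show ?thesis using PN_mult_eq_0[OF \<phi> N] by (simp add: localized_def)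
    next
      case False
      define v where "v = norm (localized \<phi> N g p)"
      have "v \<le> 1 + v ^ 2"
        using zero_le_power2[of "v - 1 / 2"] by (simp add: power2_eq_square algebra_simps)
      then have "ennreal v \<le> 1 + ennreal (v ^ 2)"
        by (simp add: ennreal_leI flip: ennreal_1 ennreal_plus)
      moreover have "fst p \<in> {-2 * N..2 * N}" using False by auto
      ultimately show ?thesis by (simp add: v_def)
    qed
  qed
  also have "\<dots> = (\<integral>\<^sup>+ p. indicator {-2 * N..2 * N} (fst p) \<partial>freq_strip N) + (\<integral>\<^sup>+ p. ennreal (norm (localized \<phi> N g p) ^ 2) \<partial>freq_strip N)"
    by (rule nn_integral_add) measurable
  also have "(\<integral>\<^sup>+ p. indicator {-2 * N..2 * N} (fst p) \<partial>freq_strip N) = (\<Sum>k\<in>freq_box N. \<integral>\<^sup>+ \<xi>. indicator {-2 * N..2 * N} \<xi> \<partial>lborel)"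
    by (subst nn_integral_freq_strip) auto
  also have "\<dots> + (\<integral>\<^sup>+ p. ennreal (norm (localized \<phi> N g p) ^ 2) \<partial>freq_strip N) < \<infinity>"
    using F2 N by (simp add: ennreal_mult_less_top ennreal_of_nat_eq_real_of_nat)
  finally show "integrable (freq_strip N) (localized \<phi> N g)"
    by (simp add: integrable_iff_bounded)
qed

text \<open>The multiplier vanishes off the box, so the infinite sum has finitely many nonzero terms
  and cannot fall back on the default value of a divergent one.\<close>

lemma evolPN_eq:
  assumes \<phi>: "cutoff \<phi>" and N: "N \<ge> 1" and F: "integrable (freq_strip N) (localized \<phi> N g)"
  shows "evolPN \<phi> N g t x y = (\<integral>p. wave 1 ((x, t, y), p) * localized \<phi> N g p \<partial>freq_strip N)"
proof -
  have integrand: "cis (2 * pi * (\<xi> * x + real_of_int k * y)) * cis (- 4 * pi ^ 2 * t * (\<xi> ^ 2 - (real_of_int k) ^ 2))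
        * complex_of_real (PN_mult \<phi> N \<xi> k) * g (\<xi>, k) = wave 1 ((x, t, y), (\<xi>, k)) * localized \<phi> N g (\<xi>, k)" for \<xi> k
    by (simp add: wave_def localized_def cis_mult mult.assoc)
  have "evolPN \<phi> N g t x y = (\<Sum>\<^sub>\<infinity>k\<in>freq_box N. \<integral>\<xi>. wave 1 ((x, t, y), (\<xi>, k)) * localized \<phi> N g (\<xi>, k) \<partial>lborel)"
    unfolding evolPN_def integrand
  proof (rule infsum_cong_neutral)
    fix k assume "k \<in> UNIV - freq_box N"
    then have "PN_mult \<phi> N \<xi> k = 0" for \<xi>
      by (intro PN_mult_eq_0[OF \<phi> N]) (auto simp: freq_box_def)
    then show "(\<integral>\<xi>. wave 1 ((x, t, y), (\<xi>, k)) * localized \<phi> N g (\<xi>, k) \<partial>lborel) = 0"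
      by (simp add: localized_def)
  qed auto
  also have "\<dots> = (\<integral>p. wave 1 ((x, t, y), p) * localized \<phi> N g p \<partial>freq_strip N)"
    using integral_freq_strip[OF integrable_wave_mult[OF F, of 1 "(x, t, y)"]] by simp
  finally show ?thesis .
qed

text \<open>At time 0 and fixed x, the k-th Fourier coefficient in y is the inverse transform of the
  slice of the data at k. Plancherel is applied slice by slice, and Parseval in y reassembles the
  slices.\<close>

lemma localized_le_L2_pow2:
  assumes \<phi>: "cutoff \<phi>" and N: "N \<ge> 1" and g: "L2_freq g"
  shows "(\<integral>\<^sup>+ p. ennreal (norm (localized \<phi> N g p) ^ 2) \<partial>freq_strip N) \<le> L2_pow2 \<phi> N g"
proof -
  define F where "F = localized \<phi> N g"
  note Fm[measurable] = localized_L2(1)[OF assms, folded F_def]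
  note F2 = localized_L2(2)[OF assms, folded F_def]
  note Fi = localized_L2(3)[OF assms, folded F_def]
  have sliceM: "(\<lambda>\<xi>. F (\<xi>, k)) \<in> borel_measurable borel" if "k \<in> freq_box N" for k
  proof -
    have "(\<lambda>\<xi>. F (\<xi>, k)) \<in> borel_measurable lborel"
      by (rule measurable_compose[OF measurable_Pair2' Fm[unfolded freq_strip_def]]) (use that in simp)
    then show ?thesis by simp
  qed
  have sum2: "(\<integral>\<^sup>+ p. ennreal (norm (F p) ^ 2) \<partial>freq_strip N) = (\<Sum>k\<in>freq_box N. \<integral>\<^sup>+ \<xi>. ennreal (norm (F (\<xi>, k)) ^ 2) \<partial>lborel)"
    by (rule nn_integral_freq_strip) measurable
  have sum1: "(\<integral>\<^sup>+ p. ennreal (norm (F p)) \<partial>freq_strip N) = (\<Sum>k\<in>freq_box N. \<integral>\<^sup>+ \<xi>. ennreal (norm (F (\<xi>, k))) \<partial>lborel)"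
    by (rule nn_integral_freq_strip) measurable
  have slice2: "(\<integral>\<^sup>+ \<xi>. ennreal (norm (F (\<xi>, k)) ^ 2) \<partial>lborel) < \<infinity>" if "k \<in> freq_box N" for k
    using F2 that unfolding sum2 by simp
  have slice1: "integrable lborel (\<lambda>\<xi>. F (\<xi>, k))" if "k \<in> freq_box N" for k
  proof -
    have "(\<integral>\<^sup>+ p. ennreal (norm (F p)) \<partial>freq_strip N) < \<infinity>" using Fi by (simp add: integrable_iff_bounded)
    then have "(\<integral>\<^sup>+ \<xi>. ennreal (norm (F (\<xi>, k))) \<partial>lborel) < \<infinity>" unfolding sum1 using that by simp
    then show ?thesis using sliceM[OF that] by (simp add: integrable_iff_bounded)
  qed
  have evol: "evolPN \<phi> N g 0 x y = (\<Sum>k\<in>freq_box N. cis (2 * pi * (real_of_int k * y)) * inv_fourier (\<lambda>\<xi>. F (\<xi>, k)) x)" for x y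
  proof -
    have "evolPN \<phi> N g 0 x y = (\<Sum>k\<in>freq_box N. \<integral>\<xi>. wave 1 ((x, 0, y), (\<xi>, k)) * F (\<xi>, k) \<partial>lborel)"
      unfolding evolPN_eq[OF \<phi> N Fi[unfolded F_def]] F_def[symmetric]
      by (rule integral_freq_strip[OF integrable_wave_mult[OF Fi]])
    also have "\<dots> = (\<Sum>k\<in>freq_box N. \<integral>\<xi>. cis (2 * pi * (real_of_int k * y)) * (cis (2 * pi * (\<xi> * x)) * F (\<xi>, k)) \<partial>lborel)"
    proof -
      have "wave 1 ((x, 0, y), (\<xi>, k)) = cis (2 * pi * (real_of_int k * y)) * cis (2 * pi * (\<xi> * x))" for \<xi> k
        by (simp add: wave_def cis_mult algebra_simps)
      then show ?thesis by (simp only: mult.assoc)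
    qed
    finally show ?thesis by (simp add: inv_fourier_def)
  qed
  have "(\<integral>\<^sup>+ p. ennreal (norm (F p) ^ 2) \<partial>freq_strip N)
     \<le> (\<Sum>k\<in>freq_box N. \<integral>\<^sup>+ x. ennreal (norm (inv_fourier (\<lambda>\<xi>. F (\<xi>, k)) x) ^ 2) \<partial>lborel)"
    unfolding sum2 by (intro sum_mono plancherel_ge slice1 slice2)
  also have "\<dots> = (\<integral>\<^sup>+ x. (\<Sum>k\<in>freq_box N. ennreal (norm (inv_fourier (\<lambda>\<xi>. F (\<xi>, k)) x) ^ 2)) \<partial>lborel)"
  proof (rule nn_integral_sum[symmetric])
    fix k assume "k \<in> freq_box N"
    note [measurable] = borel_measurable_inv_fourier[OF sliceM[OF this]]
    show "(\<lambda>x. ennreal (norm (inv_fourier (\<lambda>\<xi>. F (\<xi>, k)) x) ^ 2)) \<in> borel_measurable lborel" by measurable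
  qed
  also have "\<dots> = (\<integral>\<^sup>+ x. ennreal (\<Sum>k\<in>freq_box N. norm (inv_fourier (\<lambda>\<xi>. F (\<xi>, k)) x) ^ 2) \<partial>lborel)"
    by (intro nn_integral_cong sum_ennreal) auto
  also have "\<dots> = L2_pow2 \<phi> N g"
    unfolding L2_pow2_def evol
    by (intro nn_integral_cong)
       (subst nn_integral_unit_uniform[symmetric], measurable, rule parseval_unit_uniform[symmetric], simp)
  finally show ?thesis by (simp add: F_def)
qed

theorem theorem3p1:
  fixes \<phi> :: "real \<Rightarrow> real"
  assumes "cutoff \<phi>"
  shows "\<forall>\<epsilon>>0. \<exists>C::real. \<forall>N::real. \<forall>g. N \<ge> 1 \<longrightarrow> L2_freq g \<longrightarrow>
           L4_pow4 \<phi> N g \<le> ennreal ((C * N powr \<epsilon>) ^ 4) * (L2_pow2 \<phi> N g) ^ 2"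
proof (intro allI impI)
  fix \<epsilon> :: real assume "\<epsilon> > 0"
  \<comment> \<open>The count is taken with exponent \<open>4 * \<epsilon>\<close> because the claim
    is stated for fourth powers.\<close>
  then obtain D where D: "D > 0" and count: "\<And>N c \<tau>::real. N \<ge> 1 \<Longrightarrow>
      (\<Sum>k\<in>freq_box N. \<integral>\<^sup>+ a. ennreal (exp (- ((a\<^sup>2 - ((real_of_int k - c)\<^sup>2 + \<tau>))\<^sup>2))) \<partial>lborel) \<le> ennreal (D * N powr (4 * \<epsilon>))"
    using hyperbola_count[of "4 * \<epsilon>"] by auto
  \<comment> \<open>The fourth root of the time-weight constant times the counting constant.\<close>
  define C where "C = root 4 (sqrt (2 * pi) * exp (1 / 2) * D)"
  have C4: "C ^ 4 = sqrt (2 * pi) * exp (1 / 2) * D"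
    unfolding C_def using D by (intro real_root_pow_pos2) auto
  show "\<exists>C::real. \<forall>N::real. \<forall>g. N \<ge> 1 \<longrightarrow> L2_freq g \<longrightarrow>
           L4_pow4 \<phi> N g \<le> ennreal ((C * N powr \<epsilon>) ^ 4) * (L2_pow2 \<phi> N g) ^ 2"
  proof (intro exI[of _ C] allI impI)
    fix N :: real and g assume N: "N \<ge> 1" and g: "L2_freq g"
    note Fi = localized_L2(3)[OF assms N g]
    have "L4_pow4 \<phi> N g \<le> ennreal (sqrt (2 * pi) * exp (1 / 2)) * (ennreal (D * N powr (4 * \<epsilon>))
        * (\<integral>\<^sup>+ p. ennreal (norm (localized \<phi> N g p) ^ 2) \<partial>freq_strip N) ^ 2)"
      unfolding L4_pow4_def evolPN_eq[OF assms N Fi]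
      by (rule strichartz_freq_bound[OF Fi count[OF N]])
    also have "\<dots> \<le> ennreal (sqrt (2 * pi) * exp (1 / 2)) * (ennreal (D * N powr (4 * \<epsilon>)) * (L2_pow2 \<phi> N g) ^ 2)"
      by (intro mult_left_mono power_mono localized_le_L2_pow2[OF assms N g]) auto
    also have "\<dots> = ennreal (sqrt (2 * pi) * exp (1 / 2) * (D * N powr (4 * \<epsilon>))) * (L2_pow2 \<phi> N g) ^ 2"
      using D by (subst ennreal_mult) (auto simp: mult.assoc)
    also have "sqrt (2 * pi) * exp (1 / 2) * (D * N powr (4 * \<epsilon>)) = (C * N powr \<epsilon>) ^ 4"
      using N by (simp add: power_mult_distrib C4 powr_power mult_ac)
    finally show "L4_pow4 \<phi> N g \<le> ennreal ((C * N powr \<epsilon>) ^ 4) * (L2_pow2 \<phi> N g) ^ 2" .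
  qed
qed

end
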